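(* Let $\alpha\in(0,1)\setminus\mathbb{Q}$ with partial quotients $a_1,a_2,\dots$, and assume that the number of $n$ such that $a_n=1$ is finite. Let $n_0=\sup\{n:a_n=1\}$. Then the Hausdorff dimension of $\mathcal{V}_\alpha$ is positive if and only if $$\liminf_{n\to+\infty}\frac{\sum_{k=n_0+1}^n\log(a_k-1)}{\log q_{n+1}}>0.$$
   Context: Let $\alpha\in(0,1)\setminus\mathbb{Q}$ have the regular continued fraction expansion $\alpha=\cfrac{1}{a_1+\cfrac{1}{a_2+\cdots}}$ with partial quotients $a_n\in\mathbb{N}$, $n\ge1$. Define $p_1=0$, $p_2=1$, $q_1=1$, $q_2=a_1$, and $p_{n+1}=a_np_n+p_{n-1}$, $q_{n+1}=a_nq_n+q_{n-1}$ for $n\ge2$. Put $\alpha_n=|q_n\alpha-p_n|$ for $n\ge1$. Let $Z_\alpha=\prod_{n=1}^\infty\{0,1,\dots,a_n\}$, and let $\mathcal{V}_\alpha$ be the set of all $x\in(0,1)$ for which there exists exactly one sequence $(x_1,x_2,\dots)\in Z_\alpha$ with $x=\sum_{n=1}^\infty x_n\alpha_n$. Convention: $n_0=0$ if $a_n\ne1$ for all $n\ge1$. *)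

theory Defs
  imports "HOL-Analysis.Analysis"
begin

(* All sequences of the paper are indexed by n >= 1; here they are functions on nat,
   and a 0 is never used. *)

text \<open>\<^term>\<open>cf_frac a k n\<close> is the finite continued fraction
  1/(a k + 1/(a (k+1) + ... + 1/a (k+n-1))) with n partial quotients.\<close>

fun cf_frac :: "(nat \<Rightarrow> nat) \<Rightarrow> nat \<Rightarrow> nat \<Rightarrow> real" where
  "cf_frac a k 0 = 0"
| "cf_frac a k (Suc n) = 1 / (real (a k) + cf_frac a (Suc k) n)"

definition regular_cf_expansion :: "real \<Rightarrow> (nat \<Rightarrow> nat) \<Rightarrow> bool" where
  "regular_cf_expansion \<alpha> a \<longleftrightarrow>
     (\<forall>n\<ge>1. a n \<ge> 1) \<and> (\<lambda>n. cf_frac a 1 n) \<longlonglongrightarrow> \<alpha>"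

text \<open>The values at index 0 extend the recursion one step backwards; they only serve to
  produce the initial values at index 2.\<close>

fun cf_p :: "(nat \<Rightarrow> nat) \<Rightarrow> nat \<Rightarrow> nat" where
  "cf_p a 0 = 1"
| "cf_p a (Suc 0) = 0"
| "cf_p a (Suc (Suc n)) = a (Suc n) * cf_p a (Suc n) + cf_p a n"

fun cf_q :: "(nat \<Rightarrow> nat) \<Rightarrow> nat \<Rightarrow> nat" where
  "cf_q a 0 = 0"
| "cf_q a (Suc 0) = 1"
| "cf_q a (Suc (Suc n)) = a (Suc n) * cf_q a (Suc n) + cf_q a n"

lemma cf_initial: "cf_p a 1 = 0" "cf_p a 2 = 1" "cf_q a 1 = 1" "cf_q a 2 = a 1"
  by (simp_all add: numeral_2_eq_2)

lemma cf_recurrence: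
  assumes "n \<ge> 2"
  shows "cf_p a (n + 1) = a n * cf_p a n + cf_p a (n - 1)"
    and "cf_q a (n + 1) = a n * cf_q a n + cf_q a (n - 1)"
  using assms by (cases n; simp)+

definition alpha_seq :: "real \<Rightarrow> (nat \<Rightarrow> nat) \<Rightarrow> nat \<Rightarrow> real" where
  "alpha_seq \<alpha> a n = \<bar>real (cf_q a n) * \<alpha> - real (cf_p a n)\<bar>"

text \<open>The extensional product makes sequences agree at the unused index 0, so that
  uniqueness of a sequence means uniqueness of its entries at indices \<open>n \<ge> 1\<close>.\<close>

definition Z_set :: "(nat \<Rightarrow> nat) \<Rightarrow> (nat \<Rightarrow> nat) set" where
  "Z_set a = (\<Pi>\<^sub>E n\<in>{1..}. {0..a n})"

definition V_set :: "real \<Rightarrow> (nat \<Rightarrow> nat) \<Rightarrow> real set" where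
  "V_set \<alpha> a = {t \<in> {0<..<1}. \<exists>!x. x \<in> Z_set a \<and>
     (\<lambda>n. real (x (Suc n)) * alpha_seq \<alpha> a (Suc n)) sums t}"

text \<open>The s-th power of the diameter of a bounded set. Since \<open>0 powr 0 = 0\<close> in HOL, the usual
  convention for s = 0 (the empty set counts 0, every nonempty set counts 1) is explicit.\<close>

definition diam_powr :: "real \<Rightarrow> 'a::metric_space set \<Rightarrow> ennreal" where
  "diam_powr s U =
     (if U = {} then 0 else if s = 0 then 1 else ennreal (diameter U powr s))"

text \<open>Boundedness is required separately because \<^const>\<open>diameter\<close> is meaningless on
  unbounded sets. Finite covers are included, since members of a cover may be empty.\<close>

definition hausdorff_premeasure :: "real \<Rightarrow> real \<Rightarrow> 'a::metric_space set \<Rightarrow> ennreal" where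
  "hausdorff_premeasure s \<delta> A =
     (INF U \<in> {U :: nat \<Rightarrow> 'a set. A \<subseteq> (\<Union>i. U i) \<and>
                  (\<forall>i. bounded (U i) \<and> diameter (U i) \<le> \<delta>)}.
        (\<Sum>i. diam_powr s (U i)))"

definition hausdorff_measure :: "real \<Rightarrow> 'a::metric_space set \<Rightarrow> ennreal" where
  "hausdorff_measure s A = (SUP \<delta> \<in> {0<..}. hausdorff_premeasure s \<delta> A)"

definition hausdorff_dim :: "'a::metric_space set \<Rightarrow> ennreal" where
  "hausdorff_dim A = (INF s \<in> {s. 0 \<le> s \<and> hausdorff_measure s A = 0}. ennreal s)"

end

theory Submission
  imports Defs "HOL-Probability.Infinite_Product_Measure"
begin

text \<open>The numbers \<open>\<alpha>\<^sub>n\<close> satisfy \<open>\<alpha>\<^sub>0 = 1\<close> and \<open>\<alpha>\<^sub>n = a\<^sub>n\<^sub>+\<^sub>1 \<alpha>\<^sub>n\<^sub>+\<^sub>1 + \<alpha>\<^sub>n\<^sub>+\<^sub>2\<close>, so the values of the tails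
\<open>\<Sum>\<^sub>k\<^sub>>\<^sub>n x\<^sub>k \<alpha>\<^sub>k\<close> fill the interval from 0 to \<open>\<alpha>\<^sub>n + \<alpha>\<^sub>n\<^sub>+\<^sub>1\<close>. Comparing this length with the step \<open>\<alpha>\<^sub>n\<close> shows
that an expansion is unique exactly when no digit can be changed by one, which becomes a
combinatorial condition: a digit below the maximum \<open>a\<^sub>n\<close> is followed by digits below the maximum, and a
nonzero digit is followed by nonzero digits (\<open>unique_not_full_Suc\<close>, \<open>unique_pos_Suc\<close>,
\<open>uniquely_expandingI\<close>). Hence a uniquely expanding sequence with value in the open unit interval
eventually has only the \<open>a\<^sub>k - 1\<close> interior digits \<open>1, \<dots>, a\<^sub>k - 1\<close>, and conversely zeros up to \<open>n\<^sub>0\<close>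
followed by interior digits are uniquely expanding.

The dimension question is thus about a Cantor set with \<open>N\<^sub>n = \<Prod>\<^sub>k (a\<^sub>k - 1)\<close> cylinders at level \<open>n\<close>
(the product over \<open>n\<^sub>0 < k \<le> n\<close>), each of diameter at most about \<open>\<alpha>\<^sub>n\<close>, where \<open>\<alpha>\<^sub>n\<close> is comparable to
\<open>1 / q\<^sub>n\<^sub>+\<^sub>1\<close>. If the lower limit in the theorem vanishes, then for every \<open>s > 0\<close> there are infinitely many levels with \<open>N\<^sub>n \<le> q\<^sub>n\<^sub>+\<^sub>1\<^sup>s\<^sup>/\<^sup>2\<close>, at which the
natural cover has small \<open>s\<close>-cost (\<open>hausdorff_dim_unique_sums_0\<close>). If it is positive, then
\<open>N\<^sub>n \<ge> q\<^sub>n\<^sub>+\<^sub>1\<^sup>c\<close> for large \<open>n\<close>, and the uniform product measure on digits satisfies the hypothesis of the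
mass distribution principle with exponent \<open>min c 1\<close> (\<open>digit_image_positive\<close>). The point there is that
prefixes without maximal digits have \<open>\<alpha>\<^sub>n\<close>-separated sums (\<open>prefix_sums_separated\<close>), so that
short intervals meet few cylinders even if the partial quotients are unbounded.\<close>

section \<open>Expansions and their uniqueness\<close>

text \<open>Everything about expansions \<open>\<Sum> x\<^sub>k \<alpha>\<^sub>k\<close> follows from positivity and the recurrence
\<open>\<alpha>\<^sub>n = a\<^sub>n\<^sub>+\<^sub>1 \<alpha>\<^sub>n\<^sub>+\<^sub>1 + \<alpha>\<^sub>n\<^sub>+\<^sub>2\<close>, which is Euclid's algorithm read off the remainders. The sequence is
written \<open>A\<close> here; index 0 matters, since \<open>\<alpha>\<^sub>0 = 1\<close> is the length of the unit interval.\<close>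

locale remainder_sequence =
  fixes a :: "nat \<Rightarrow> nat" and A :: "nat \<Rightarrow> real"
  assumes a_ge_1: "1 \<le> n \<Longrightarrow> 1 \<le> a n"
    and A_pos: "0 < A n"
    and A_rec: "A n = real (a (Suc n)) * A (Suc n) + A (Suc (Suc n))"
begin

lemma A_add_le: "A (Suc n) + A (Suc (Suc n)) \<le> A n"
  using A_rec[of n] a_ge_1[of "Suc n"] A_pos[of "Suc n"]
    mult_right_mono[of 1 "real (a (Suc n))" "A (Suc n)"] by simp

lemma A_less: "A (Suc n) < A n"
  using A_add_le[of n] A_pos[of "Suc (Suc n)"] by linarith

lemma A_antimono: "m \<le> n \<Longrightarrow> A n \<le> A m"
  by (rule lift_Suc_antimono_le[of A]) (auto intro: less_imp_le A_less)

lemma A_tendsto_0: "A \<longlonglongrightarrow> 0"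
proof -
  have "decseq A"
    by (simp add: decseq_def A_antimono)
  then obtain L where L: "A \<longlonglongrightarrow> L" "\<And>i. L \<le> A i"
    using decseq_convergent[of A 0] A_pos less_imp_le by metis
  have "(\<lambda>n. A (Suc n) + A (Suc (Suc n))) \<longlonglongrightarrow> L + L"
    by (intro tendsto_add LIMSEQ_Suc L(1))
  then have "L + L \<le> L"
    using L(1) A_add_le by (intro LIMSEQ_le) auto
  moreover have "0 \<le> L"
    using L(1) A_pos by (intro LIMSEQ_le_const[OF L(1)]) (auto intro: less_imp_le)
  ultimately show ?thesis using L(1) by (simp add: antisym)
qed

text \<open>Since \<open>a\<^sub>k \<alpha>\<^sub>k = \<alpha>\<^sub>k\<^sub>-\<^sub>1 - \<alpha>\<^sub>k\<^sub>+\<^sub>1\<close>, the largest value of a block of digits is a telescoping sum.\<close>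

lemma sum_digits_max:
  assumes "j \<le> n"
  shows "(\<Sum>k = Suc j..n. real (a k) * A k) = A j + A (Suc j) - A n - A (Suc n)"
  using assms
proof (induction rule: dec_induct)
  case (step n)
  then show ?case using A_rec[of n] by simp
qed simp

lemma sum_digits_less:
  assumes "j \<le> n"
  shows "(\<Sum>k = Suc j..n. (real (a k) - 1) * A k) \<le> A j - A n"
proof (cases "j = n")
  case False
  have "A (Suc j) \<le> (\<Sum>k = Suc j..n. A k)"
    using False assms A_pos by (intro member_le_sum) (auto intro: less_imp_le)
  then show ?thesis
    using sum_digits_max[OF assms] A_pos[of "Suc n"]
    by (simp add: left_diff_distrib sum_subtractf)
qed simp

lemma sums_digits_max: "(\<lambda>k. real (a (Suc (n + k))) * A (Suc (n + k))) sums (A n + A (Suc n))"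
proof -
  have *: "(\<Sum>k<m. real (a (Suc (n + k))) * A (Suc (n + k)))
      = A n + A (Suc n) - A (n + m) - A (Suc (n + m))" for m
  proof (induction m)
    case (Suc m)
    then show ?case using A_rec[of "n + m"] by simp
  qed simp
  have "(\<lambda>m. A (n + m)) \<longlonglongrightarrow> 0" "(\<lambda>m. A (Suc (n + m))) \<longlonglongrightarrow> 0"
    using LIMSEQ_ignore_initial_segment[OF A_tendsto_0, of n]
      LIMSEQ_ignore_initial_segment[OF A_tendsto_0, of "Suc n"] by (simp_all add: add.commute)
  from tendsto_diff[OF tendsto_diff[OF tendsto_const this(1)] this(2), of "A n + A (Suc n)"]
  show ?thesis by (simp add: sums_def *)
qed

definition tail :: "(nat \<Rightarrow> nat) \<Rightarrow> nat \<Rightarrow> real" where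
  "tail x n = (\<Sum>k. real (x (Suc (n + k))) * A (Suc (n + k)))"

lemma summable_tail:
  assumes "\<And>k. n < k \<Longrightarrow> x k \<le> a k"
  shows "summable (\<lambda>k. real (x (Suc (n + k))) * A (Suc (n + k)))"
proof (rule summable_comparison_test')
  show "summable (\<lambda>k. real (a (Suc (n + k))) * A (Suc (n + k)))"
    using sums_digits_max by (rule sums_summable)
  show "norm (real (x (Suc (n + k))) * A (Suc (n + k)))
      \<le> real (a (Suc (n + k))) * A (Suc (n + k))" for k
    using assms[of "Suc (n + k)"] A_pos[of "Suc (n + k)"]
    by (auto simp: abs_mult intro!: mult_right_mono)
qed

lemma tail_nonneg: "(\<And>k. n < k \<Longrightarrow> x k \<le> a k) \<Longrightarrow> 0 \<le> tail x n"
  unfolding tail_def using A_pos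
  by (intro suminf_nonneg summable_tail mult_nonneg_nonneg) (auto intro: less_imp_le)

lemma tail_le:
  assumes "\<And>k. n < k \<Longrightarrow> x k \<le> a k"
  shows "tail x n \<le> A n + A (Suc n)"
proof -
  have "tail x n \<le> (\<Sum>k. real (a (Suc (n + k))) * A (Suc (n + k)))"
    unfolding tail_def using A_pos assms
    by (intro suminf_le summable_tail mult_right_mono)
      (auto intro: less_imp_le)
  then show ?thesis using sums_digits_max[of n] by (simp add: sums_iff)
qed

lemma tail_Suc:
  assumes "\<And>k. n < k \<Longrightarrow> x k \<le> a k"
  shows "tail x n = real (x (Suc n)) * A (Suc n) + tail x (Suc n)"
  using suminf_split_head[OF summable_tail[of n x]] assms by (simp add: tail_def)

lemma tail_split:
  assumes "\<And>k. 0 < k \<Longrightarrow> x k \<le> a k"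
  shows "tail x 0 = (\<Sum>k = 1..n. real (x k) * A k) + tail x n"
proof (induction n)
  case (Suc n)
  then show ?case using tail_Suc[of n x] assms by simp
qed simp

lemma tail_cong: "(\<And>k. n < k \<Longrightarrow> x k = y k) \<Longrightarrow> tail x n = tail y n"
  by (simp add: tail_def)

lemma summable_A: "summable (\<lambda>k. A (Suc (n + k)))"
  using summable_tail[of n "\<lambda>_. 1"] a_ge_1 by simp

lemma suminf_A_greater: "A (Suc n) < (\<Sum>k. A (Suc (n + k)))"
proof -
  have "(\<Sum>k<2. A (Suc (n + k))) \<le> (\<Sum>k. A (Suc (n + k)))"
    using A_pos by (intro sum_le_suminf summable_A) (auto intro: less_imp_le)
  then show ?thesis using A_pos[of "Suc (Suc n)"] by (simp add: numeral_2_eq_2)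
qed

lemma tail_greater:
  assumes "\<And>k. n < k \<Longrightarrow> x k \<le> a k" "\<And>k. n < k \<Longrightarrow> 0 < x k"
  shows "A (Suc n) < tail x n"
proof -
  have "A (Suc n) < (\<Sum>k. A (Suc (n + k)))" by (rule suminf_A_greater)
  also have "\<dots> \<le> tail x n"
    unfolding tail_def
  proof (intro suminf_le summable_A summable_tail assms(1))
    fix k
    show "A (Suc (n + k)) \<le> real (x (Suc (n + k))) * A (Suc (n + k))"
      using mult_right_mono[of 1 "real (x (Suc (n + k)))" "A (Suc (n + k))"]
        assms(2)[of "Suc (n + k)"] A_pos[of "Suc (n + k)"] by simp
  qed
  finally show ?thesis .
qed

text \<open>The reflection \<open>x\<^sub>k \<mapsto> a\<^sub>k - x\<^sub>k\<close> turns lower bounds for tails into upper bounds.\<close>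

lemma tail_complement:
  assumes "\<And>k. n < k \<Longrightarrow> x k \<le> a k"
  shows "tail (\<lambda>k. a k - x k) n = A n + A (Suc n) - tail x n"
proof -
  have "(\<lambda>k. real (a (Suc (n + k))) * A (Suc (n + k)) - real (x (Suc (n + k))) * A (Suc (n + k)))
      sums (A n + A (Suc n) - tail x n)"
    unfolding tail_def
    by (intro sums_diff sums_digits_max summable_sums summable_tail assms)
  then have "(\<lambda>k. real (a (Suc (n + k)) - x (Suc (n + k))) * A (Suc (n + k)))
      sums (A n + A (Suc n) - tail x n)"
    using assms by (simp add: of_nat_diff left_diff_distrib)
  then show ?thesis by (simp add: tail_def sums_iff)
qed

lemma tail_less:
  assumes "\<And>k. n < k \<Longrightarrow> x k < a k"
  shows "tail x n < A n"
proof -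
  have "A (Suc n) < tail (\<lambda>k. a k - x k) n"
    by (rule tail_greater) (simp_all add: assms)
  also have "\<dots> = A n + A (Suc n) - tail x n"
    by (rule tail_complement) (simp add: assms less_imp_le)
  finally show ?thesis by simp
qed

text \<open>The greedy algorithm represents every number between the extreme tails: choosing the digit
\<open>min a\<^sub>k \<lfloor>u / \<alpha>\<^sub>k\<rfloor>\<close> leaves a remainder that is again between the extreme tails of the next level.\<close>

lemma expansion_exists:
  assumes "0 \<le> r" "r \<le> A n + A (Suc n)"
  obtains y where "\<And>k. n < k \<Longrightarrow> y k \<le> a k" "tail y n = r"
proof -
  define P where "P k u \<longleftrightarrow> 0 \<le> u \<and> u \<le> A (n + k) + A (Suc (n + k)) \<and> (k = 0 \<longrightarrow> u = r)"
    for k :: nat and u :: real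
  define Q where "Q k u v \<longleftrightarrow> (\<exists>d \<le> a (Suc (n + k)). v = u - real d * A (Suc (n + k)))"
    for k :: nat and u v :: real
  \<comment> \<open>One greedy step; the recurrence is what bounds the remainder when the maximal digit is chosen.\<close>
  have step: "\<exists>v. P (Suc k) v \<and> Q k u v" if "P k u" for k u
  proof -
    let ?b = "a (Suc (n + k))" and ?B = "A (Suc (n + k))"
    define d where "d = min ?b (nat \<lfloor>u / ?B\<rfloor>)"
    have B: "0 < ?B" by (rule A_pos)
    have u: "0 \<le> u" "u \<le> A (n + k) + ?B" using that by (auto simp: P_def)
    have "real (nat \<lfloor>u / ?B\<rfloor>) = \<lfloor>u / ?B\<rfloor>" using u(1) B by simp
    then have fl: "real (nat \<lfloor>u / ?B\<rfloor>) \<le> u / ?B" "u / ?B < real (nat \<lfloor>u / ?B\<rfloor>) + 1"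
      by linarith+
    then have "real d \<le> u / ?B" by (simp add: d_def min_def)
    then have lo: "real d * ?B \<le> u" using B by (simp add: pos_le_divide_eq)
    have hi: "u - real d * ?B \<le> ?B + A (Suc (Suc (n + k)))"
    proof (cases "?b \<le> nat \<lfloor>u / ?B\<rfloor>")
      case True
      then have "d = ?b" by (simp add: d_def)
      then show ?thesis using u(2) A_rec[of "n + k"] by simp
    next
      case False
      then have "u / ?B < real d + 1" using fl(2) by (simp add: d_def)
      then have "u < real d * ?B + ?B" using B by (simp add: pos_divide_less_eq distrib_right)
      then show ?thesis using A_pos[of "Suc (Suc (n + k))"] by linarith
    qed
    have "P (Suc k) (u - real d * ?B)" using lo hi by (simp add: P_def)
    moreover have "Q k u (u - real d * ?B)" unfolding Q_def by (rule exI[of _ d]) (simp add: d_def)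
    ultimately show ?thesis by blast
  qed
  have "P 0 r" using assms by (simp add: P_def)
  then have ex0: "\<exists>u. P 0 u" by blast
  obtain f where f: "\<And>k. P k (f k)" "\<And>k. Q k (f k) (f (Suc k))"
    using dependent_nat_choice[of P Q, OF ex0 step] by blast
  then obtain d where d: "\<And>k. d k \<le> a (Suc (n + k))"
      "\<And>k. f (Suc k) = f k - real (d k) * A (Suc (n + k))"
    unfolding Q_def by metis
  have "f 0 = r" using f(1)[of 0] by (simp add: P_def)
  then have sum: "(\<Sum>k<m. real (d k) * A (Suc (n + k))) = r - f m" for m
    by (induction m) (simp_all add: d(2))
  have "(\<lambda>k. A (n + k) + A (Suc (n + k))) \<longlonglongrightarrow> 0 + 0"
    using LIMSEQ_ignore_initial_segment[OF A_tendsto_0, of n]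
      LIMSEQ_ignore_initial_segment[OF A_tendsto_0, of "Suc n"]
    by (intro tendsto_add) (simp_all add: add.commute)
  then have "f \<longlonglongrightarrow> 0"
    using f(1) by (intro tendsto_sandwich[of "\<lambda>_. 0" f _ "\<lambda>k. A (n + k) + A (Suc (n + k))"])
      (auto simp: P_def)
  then have "(\<lambda>k. real (d k) * A (Suc (n + k))) sums r"
    using tendsto_diff[OF tendsto_const[of r]] by (fastforce simp: sums_def sum)
  then have "tail (\<lambda>k. d (k - Suc n)) n = r" by (simp add: tail_def sums_iff)
  moreover have "d (k - Suc n) \<le> a k" if "n < k" for k using d(1)[of "k - Suc n"] that by simp
  ultimately show thesis by (intro that[of "\<lambda>k. d (k - Suc n)"])
qed

definition uniquely_expanding :: "(nat \<Rightarrow> nat) \<Rightarrow> bool" where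
  "uniquely_expanding x \<longleftrightarrow> x \<in> Z_set a \<and> (\<forall>y \<in> Z_set a. tail y 0 = tail x 0 \<longrightarrow> y = x)"

lemma Z_set_le: "x \<in> Z_set a \<Longrightarrow> 0 < k \<Longrightarrow> x k \<le> a k"
  by (auto simp: Z_set_def PiE_iff)

lemma unique_le: "uniquely_expanding x \<Longrightarrow> 0 < k \<Longrightarrow> x k \<le> a k"
  unfolding uniquely_expanding_def by (blast intro: Z_set_le)

text \<open>A uniquely expanding sequence admits no change of a single digit: if the tail could absorb the
change of the \<open>n\<close>-th digit to \<open>d\<close>, then by the existence of expansions the new tail would have
digits of its own, and splicing them in would give a second expansion.\<close>

lemma digit_forced:
  assumes x: "uniquely_expanding x" and n: "0 < n" and d: "d \<le> a n" "d \<noteq> x n"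
    and lo: "0 \<le> tail x n + (real (x n) - real d) * A n"
    and hi: "tail x n + (real (x n) - real d) * A n \<le> A n + A (Suc n)"
  shows False
proof -
  have xZ: "x \<in> Z_set a" using x by (simp add: uniquely_expanding_def)
  obtain y where y: "\<And>k. n < k \<Longrightarrow> y k \<le> a k"
      "tail y n = tail x n + (real (x n) - real d) * A n"
    using expansion_exists[OF lo hi] by blast
  define z where "z k = (if k < n then x k else if k = n then d else y k)" for k
  have zZ: "z \<in> Z_set a"
    using xZ d(1) n y(1) by (auto simp: Z_set_def PiE_iff z_def extensional_def)
  have "tail z n = tail y n" by (rule tail_cong) (simp add: z_def)
  moreover obtain m where m: "n = Suc m" using n by (cases n) auto
  moreover have "(\<Sum>k = 1..m. real (z k) * A k) = (\<Sum>k = 1..m. real (x k) * A k)"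
    by (intro sum.cong) (auto simp: z_def m)
  ultimately have "tail z 0 = tail x 0"
    using tail_split[of z n] tail_split[of x n] Z_set_le[OF zZ] Z_set_le[OF xZ] y(2)
    by (simp add: z_def left_diff_distrib)
  then have "z = x" using x zZ by (simp add: uniquely_expanding_def)
  then show False using d(2) by (auto simp: z_def fun_eq_iff split: if_splits)
qed

text \<open>If the tail were larger, the \<open>n\<close>-th digit could be raised by one; the mirror bound below holds because
the digit could otherwise be lowered.\<close>

lemma unique_tail_less:
  assumes x: "uniquely_expanding x" and "0 < n" "x n < a n"
  shows "tail x n < A n"
proof (rule ccontr)
  assume "\<not> ?thesis"
  moreover have "tail x n \<le> A n + A (Suc n)"
    by (intro tail_le unique_le[OF x]) simp
  ultimately show False
    using digit_forced[OF x \<open>0 < n\<close>, of "Suc (x n)"] assms(3) A_pos[of n]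
    by (simp add: distrib_right)
qed

lemma unique_tail_greater:
  assumes x: "uniquely_expanding x" and "0 < n" "0 < x n"
  shows "A (Suc n) < tail x n"
proof (rule ccontr)
  assume "\<not> ?thesis"
  moreover have "0 \<le> tail x n" "x n \<le> a n"
    using \<open>0 < n\<close> by (auto intro!: tail_nonneg unique_le[OF x])
  ultimately show False
    using digit_forced[OF x \<open>0 < n\<close>, of "x n - 1"] assms(3) A_pos[of n]
    by (cases "x n") auto
qed

text \<open>A maximal digit at \<open>n + 1\<close> has a tail larger than \<open>\<alpha>\<^sub>n\<^sub>+\<^sub>2\<close>, so the tail at \<open>n\<close> would exceed
\<open>a\<^sub>n\<^sub>+\<^sub>1 \<alpha>\<^sub>n\<^sub>+\<^sub>1 + \<alpha>\<^sub>n\<^sub>+\<^sub>2 = \<alpha>\<^sub>n\<close>, too much after a non-maximal digit.\<close>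

lemma unique_not_full_Suc:
  assumes x: "uniquely_expanding x" and n: "0 < n" "x n < a n"
  shows "x (Suc n) < a (Suc n)"
proof (rule ccontr)
  assume "\<not> ?thesis"
  then have full: "x (Suc n) = a (Suc n)" using unique_le[OF x, of "Suc n"] by simp
  then have "A (Suc (Suc n)) < tail x (Suc n)"
    using unique_tail_greater[OF x, of "Suc n"] a_ge_1[of "Suc n"] by simp
  moreover have "tail x n = real (a (Suc n)) * A (Suc n) + tail x (Suc n)"
    using tail_Suc[of n x, OF unique_le[OF x]] full by simp
  ultimately show False
    using unique_tail_less[OF x n] A_rec[of n] by linarith
qed

text \<open>A zero digit at \<open>n + 1\<close> has a tail smaller than \<open>\<alpha>\<^sub>n\<^sub>+\<^sub>1\<close>, which is then also the tail at \<open>n\<close>, too small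
after a nonzero digit.\<close>

lemma unique_pos_Suc:
  assumes x: "uniquely_expanding x" and n: "0 < n" "0 < x n"
  shows "0 < x (Suc n)"
proof (rule ccontr)
  assume "\<not> ?thesis"
  then have 0: "x (Suc n) = 0" by simp
  then have "tail x (Suc n) < A (Suc n)"
    using unique_tail_less[OF x, of "Suc n"] a_ge_1[of "Suc n"] by simp
  moreover have "tail x n = tail x (Suc n)"
    using tail_Suc[of n x, OF unique_le[OF x]] 0 by simp
  ultimately show False
    using unique_tail_greater[OF x n] by linarith
qed

text \<open>The converse: both properties persist to the right, so at the first index where a competitor differs
the tail of \<open>x\<close> is too small to compensate a larger digit of the competitor, and too large to
compensate a smaller one.\<close>

lemma uniquely_expandingI:
  assumes Z: "x \<in> Z_set a"
    and pos: "\<And>n. 0 < n \<Longrightarrow> 0 < x n \<Longrightarrow> 0 < x (Suc n)"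
    and less: "\<And>n. 0 < n \<Longrightarrow> x n < a n \<Longrightarrow> x (Suc n) < a (Suc n)"
  shows "uniquely_expanding x"
  unfolding uniquely_expanding_def
proof (intro conjI ballI impI Z)
  fix y assume y: "y \<in> Z_set a" and eq: "tail y 0 = tail x 0"
  have pos': "0 < x k" if "0 < n" "0 < x n" "n \<le> k" for n k
    using that(3,1,2) by (induction rule: dec_induct) (use pos in auto)
  have less': "x k < a k" if "0 < n" "x n < a n" "n \<le> k" for n k
    using that(3,1,2) by (induction rule: dec_induct) (use less in auto)
  note le = Z_set_le[OF Z] Z_set_le[OF y]
  have "x n = y n" if "0 < n" for n
    using that
  proof (induction n rule: less_induct)
    case (less n)
    then obtain m where m: "n = Suc m" by (cases n) auto
    have "(\<Sum>k = 1..m. real (x k) * A k) = (\<Sum>k = 1..m. real (y k) * A k)"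
      using less.IH by (intro sum.cong) (auto simp: m)
    then have bal: "real (x n) * A n + tail x n = real (y n) * A n + tail y n"
      using tail_split[of x n] tail_split[of y n] le eq by (simp add: m)
    show ?case
    proof (rule linorder_cases)
      assume lt: "x n < y n"
      then have "tail x n < A n"
        using less'[OF less.prems] le(2)[OF less.prems] by (intro tail_less) auto
      moreover have "(real (x n) + 1) * A n \<le> real (y n) * A n"
        using lt A_pos[of n] by (intro mult_right_mono) auto
      moreover have "0 \<le> tail y n" using le by (intro tail_nonneg) auto
      ultimately show ?thesis using bal by (simp add: distrib_right)
    next
      assume gt: "y n < x n"
      then have "A (Suc n) < tail x n"
        using pos'[OF less.prems] le by (intro tail_greater) auto
      moreover have "(real (y n) + 1) * A n \<le> real (x n) * A n"
        using gt A_pos[of n] by (intro mult_right_mono) auto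
      moreover have "tail y n \<le> A n + A (Suc n)" using le by (intro tail_le) auto
      ultimately show ?thesis using bal by (simp add: distrib_right)
    qed
  qed
  then show "y = x"
    using Z y unfolding Z_set_def by (intro PiE_ext[of y _ _ x]) auto
qed

text \<open>Excluding the two extreme values leaves sequences with some nonzero and some non-maximal
digit; from there on both properties are inherited.\<close>

lemma unique_eventually_interior:
  assumes x: "uniquely_expanding x" and pos: "0 < tail x 0" and less: "tail x 0 < A 0 + A 1"
  shows "\<exists>m. \<forall>k>m. 0 < x k \<and> x k < a k"
proof -
  note le = unique_le[OF x]
  have "\<exists>i>0. 0 < x i"
  proof (rule ccontr)
    assume no: "\<nexists>i. 0 < i \<and> 0 < x i"
    have "x k = 0" if "0 < k" for k
      using no that by (metis gr0I)
    then have "tail x 0 = tail (\<lambda>_. 0) 0" by (intro tail_cong) simp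
    then show False using pos by (simp add: tail_def)
  qed
  then obtain i where i: "0 < i" "0 < x i" by blast
  have "\<exists>j>0. x j < a j"
  proof (rule ccontr)
    assume no: "\<nexists>j. 0 < j \<and> x j < a j"
    have "x k = a k" if "0 < k" for k
      using no le[OF that] that by (metis order_le_less)
    then have "tail x 0 = tail a 0" by (intro tail_cong) simp
    then show False using less sums_digits_max[of 0] by (simp add: tail_def sums_iff)
  qed
  then obtain j where j: "0 < j" "x j < a j" by blast
  have "0 < x k" if "i \<le> k" for k
    using that i by (induction rule: dec_induct) (auto intro: unique_pos_Suc[OF x])
  moreover have "x k < a k" if "j \<le> k" for k
    using that j by (induction rule: dec_induct) (auto intro: unique_not_full_Suc[OF x])
  ultimately show ?thesis by (intro exI[of _ "max i j"]) auto
qed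

text \<open>Without maximal digits, prefixes of length \<open>n\<close> behave like integers on the scale \<open>\<alpha>\<^sub>n\<close>: after the
first difference, at index \<open>j\<close>, the remaining digits can close at most \<open>\<alpha>\<^sub>j - \<alpha>\<^sub>n\<close> of the gap.\<close>

lemma prefix_sums_separated:
  assumes x: "\<And>k. 0 < k \<Longrightarrow> x k < a k" and y: "\<And>k. 0 < k \<Longrightarrow> y k < a k"
    and ne: "\<exists>k \<in> {1..n}. x k \<noteq> y k"
  shows "A n \<le> \<bar>(\<Sum>k = 1..n. real (x k) * A k) - (\<Sum>k = 1..n. real (y k) * A k)\<bar>"
proof -
  define j where "j = (LEAST k. k \<in> {1..n} \<and> x k \<noteq> y k)"
  have ex: "\<exists>k. k \<in> {1..n} \<and> x k \<noteq> y k" using ne by blast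
  have j: "1 \<le> j" "j \<le> n" "x j \<noteq> y j"
    using LeastI_ex[OF ex] unfolding j_def[symmetric] by auto
  have before: "x k = y k" if "1 \<le> k" "k < j" for k
    using not_less_Least[of k "\<lambda>k. k \<in> {1..n} \<and> x k \<noteq> y k"] that j(2)
    unfolding j_def[symmetric] by auto
  let ?d = "\<lambda>k. (real (x k) - real (y k)) * A k"
  have "(\<Sum>k = 1..n. real (x k) * A k) - (\<Sum>k = 1..n. real (y k) * A k) = (\<Sum>k = 1..n. ?d k)"
    by (simp add: sum_subtractf left_diff_distrib)
  also have "\<dots> = (\<Sum>k = j..n. ?d k)"
    using j before by (intro sum.mono_neutral_right) auto
  also have "\<dots> = ?d j + (\<Sum>k = Suc j..n. ?d k)"
    using j(2) by (rule sum.atLeast_Suc_atMost)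
  finally have eq: "(\<Sum>k = 1..n. real (x k) * A k) - (\<Sum>k = 1..n. real (y k) * A k)
    = ?d j + (\<Sum>k = Suc j..n. ?d k)" .
  have "1 \<le> \<bar>real (x j) - real (y j)\<bar>" using j(3) by linarith
  then have "A j \<le> \<bar>?d j\<bar>"
    using mult_right_mono[of 1 "\<bar>real (x j) - real (y j)\<bar>" "A j"] A_pos[of j] by (simp add: abs_mult)
  moreover have "\<bar>\<Sum>k = Suc j..n. ?d k\<bar> \<le> (\<Sum>k = Suc j..n. (real (a k) - 1) * A k)"
  proof (rule sum_abs[THEN order_trans], rule sum_mono)
    fix k assume k: "k \<in> {Suc j..n}"
    then have "\<bar>real (x k) - real (y k)\<bar> \<le> real (a k) - 1"
      using x[of k] y[of k] by auto
    then show "\<bar>?d k\<bar> \<le> (real (a k) - 1) * A k"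
      using A_pos[of k] by (simp add: abs_mult mult_right_mono)
  qed
  moreover note sum_digits_less[OF j(2)]
  ultimately show ?thesis unfolding eq by linarith
qed

end

section \<open>Hausdorff measure\<close>

lemma hausdorff_premeasure_le:
  assumes "A \<subseteq> (\<Union>i. U i)" "\<And>i. bounded (U i)" "\<And>i. diameter (U i) \<le> \<delta>"
  shows "hausdorff_premeasure s \<delta> A \<le> (\<Sum>i. diam_powr s (U i))"
  unfolding hausdorff_premeasure_def using assms by (intro INF_lower) auto

lemma hausdorff_premeasure_mono:
  assumes "A \<subseteq> B" "\<delta>' \<le> \<delta>"
  shows "hausdorff_premeasure s \<delta> A \<le> hausdorff_premeasure s \<delta>' B"
  unfolding hausdorff_premeasure_def using assms
  by (intro INF_superset_mono) (auto intro: order_trans)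

lemma hausdorff_measure_mono: "A \<subseteq> B \<Longrightarrow> hausdorff_measure s A \<le> hausdorff_measure s B"
  unfolding hausdorff_measure_def by (intro SUP_mono') (rule hausdorff_premeasure_mono, auto)

lemma hausdorff_measure_eq_0_iff:
  "hausdorff_measure s A = 0 \<longleftrightarrow> (\<forall>\<delta>>0. hausdorff_premeasure s \<delta> A = 0)"
  by (auto simp: hausdorff_measure_def simp flip: bot_ennreal)

text \<open>Sets of diameter at most 1 cost no more for a larger exponent, so it suffices to use such covers.\<close>

lemma hausdorff_measure_null_exponent:
  assumes "0 \<le> s" "s \<le> s'" "hausdorff_measure s A = 0"
  shows "hausdorff_measure s' A = 0"
  unfolding hausdorff_measure_eq_0_iff
proof (intro allI impI)
  fix \<delta> :: real assume "0 < \<delta>"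
  have pow: "diam_powr s' U \<le> diam_powr s U" if "bounded U" "diameter U \<le> min \<delta> 1" for U :: "'a set"
    using that assms(1,2) diameter_ge_0[OF that(1)] powr_mono'[of s s' "diameter U"]
    by (auto simp: diam_powr_def ennreal_leI powr_le1 simp flip: ennreal_1)
  have "hausdorff_premeasure s' \<delta> A \<le> hausdorff_premeasure s' (min \<delta> 1) A"
    by (intro hausdorff_premeasure_mono) auto
  also have "\<dots> \<le> hausdorff_premeasure s (min \<delta> 1) A"
    unfolding hausdorff_premeasure_def
    by (intro INF_mono bexI) (use pow in \<open>auto intro!: suminf_le\<close>)
  also have "\<dots> = 0"
    using assms(3) \<open>0 < \<delta>\<close> by (simp add: hausdorff_measure_eq_0_iff)
  finally show "hausdorff_premeasure s' \<delta> A = 0" by simp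
qed

lemma hausdorff_dim_ge:
  assumes "0 \<le> s" "hausdorff_measure s A \<noteq> 0"
  shows "ennreal s \<le> hausdorff_dim A"
  unfolding hausdorff_dim_def
proof (rule INF_greatest)
  fix s' assume s': "s' \<in> {s. 0 \<le> s \<and> hausdorff_measure s A = 0}"
  then have "\<not> s' \<le> s" using hausdorff_measure_null_exponent[of s' s A] assms(2) by auto
  then show "ennreal s \<le> ennreal s'" by (intro ennreal_leI) simp
qed

lemma hausdorff_dim_le: "0 \<le> s \<Longrightarrow> hausdorff_measure s A = 0 \<Longrightarrow> hausdorff_dim A \<le> ennreal s"
  unfolding hausdorff_dim_def by (intro INF_lower) simp

text \<open>Countable unions are needed because the digits of a uniquely expanding sequence are restricted
only from some index on, which depends on the sequence.\<close>

lemma hausdorff_measure_UN_null: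
  fixes A :: "nat \<Rightarrow> 'a::metric_space set"
  assumes null: "\<And>m. hausdorff_measure s (A m) = 0"
  shows "hausdorff_measure s (\<Union>m. A m) = 0"
  unfolding hausdorff_measure_eq_0_iff
proof (intro allI impI)
  fix \<delta> :: real assume \<delta>: "0 < \<delta>"
  have le: "hausdorff_premeasure s \<delta> (\<Union>m. A m) \<le> 0 + ennreal e" if e: "0 < e" for e
  proof -
    have "\<exists>U. A m \<subseteq> (\<Union>i. U i) \<and> (\<forall>i. bounded (U i) \<and> diameter (U i) \<le> \<delta>) \<and>
        (\<Sum>i. diam_powr s (U i)) < ennreal (e * (1/2) ^ Suc m)" for m
    proof -
      have "hausdorff_premeasure s \<delta> (A m) < ennreal (e * (1/2) ^ Suc m)"
        using null[of m] \<delta> e by (simp add: hausdorff_measure_eq_0_iff)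
      then show ?thesis
        unfolding hausdorff_premeasure_def INF_less_iff by blast
    qed
    then obtain U where U: "\<And>m. A m \<subseteq> (\<Union>i. U m i)"
        "\<And>m i. bounded (U m i)" "\<And>m i. diameter (U m i) \<le> \<delta>"
        "\<And>m. (\<Sum>i. diam_powr s (U m i)) < ennreal (e * (1/2) ^ Suc m)"
      by metis
    define V where "V p = (case prod_decode p of (m, i) \<Rightarrow> U m i)" for p
    have "(\<Union>m. A m) \<subseteq> (\<Union>p. V p)"
    proof
      fix t assume "t \<in> (\<Union>m. A m)"
      then obtain m i where "t \<in> U m i" using U(1) by blast
      then have "t \<in> V (prod_encode (m, i))" by (simp add: V_def)
      then show "t \<in> (\<Union>p. V p)" by blast
    qed
    then have "hausdorff_premeasure s \<delta> (\<Union>m. A m) \<le> (\<Sum>p. diam_powr s (V p))"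
      using U(2,3) by (intro hausdorff_premeasure_le) (auto simp: V_def split: prod.split)
    also have "\<dots> = (\<Sum>p. (\<lambda>(m, i). diam_powr s (U m i)) (prod_decode p))"
      by (simp add: V_def prod.case_eq_if)
    also have "\<dots> = (\<Sum>m. \<Sum>i. diam_powr s (U m i))"
      by (rule suminf_ennreal_2dimen) simp
    also have "\<dots> \<le> (\<Sum>m. ennreal (e * (1/2) ^ Suc m))"
      using U(4) by (intro suminf_le less_imp_le) auto
    also have "\<dots> = ennreal e"
      using sums_mult[OF power_half_series, of e] e by (intro suminf_ennreal_eq) auto
    finally show ?thesis by simp
  qed
  have "hausdorff_premeasure s \<delta> (\<Union>m. A m) \<le> 0"
    by (rule ennreal_le_epsilon) (rule le)
  then show "hausdorff_premeasure s \<delta> (\<Union>m. A m) = 0" by simp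
qed

lemma hausdorff_premeasure_finite_cover:
  assumes F: "finite F" and cover: "A \<subseteq> (\<Union>i\<in>F. B i)" and s: "0 < s" and d: "0 \<le> d" "d \<le> \<delta>"
    and B: "\<And>i. i \<in> F \<Longrightarrow> bounded (B i)" "\<And>i. i \<in> F \<Longrightarrow> diameter (B i) \<le> d"
  shows "hausdorff_premeasure s \<delta> A \<le> ennreal (real (card F) * d powr s)"
proof -
  obtain h where h: "bij_betw h {0..<card F} F" using ex_bij_betw_nat_finite[OF F] by blast
  define U where "U i = (if i < card F then B (h i) else {})" for i
  have hF: "h i \<in> F" if "i < card F" for i using h that by (auto simp: bij_betw_def)
  have U: "bounded (U i)" "diameter (U i) \<le> \<delta>" for i
    using B[OF hF] d by (auto simp: U_def intro: order_trans)
  have "A \<subseteq> (\<Union>i. U i)"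
  proof
    fix t assume "t \<in> A"
    then obtain j where "j \<in> F" "t \<in> B j" using cover by blast
    then have "j \<in> h ` {0..<card F}" using h by (simp add: bij_betw_def)
    then obtain i where "i < card F" "h i = j" by auto
    then have "t \<in> U i" using \<open>t \<in> B j\<close> by (simp add: U_def)
    then show "t \<in> (\<Union>i. U i)" by blast
  qed
  then have "hausdorff_premeasure s \<delta> A \<le> (\<Sum>i. diam_powr s (U i))"
    by (rule hausdorff_premeasure_le) (rule U)+
  also have "\<dots> = (\<Sum>i<card F. diam_powr s (U i))"
    by (intro suminf_finite) (auto simp: U_def diam_powr_def)
  also have "\<dots> \<le> (\<Sum>i<card F. ennreal (d powr s))"
  proof (rule sum_mono)
    fix i assume "i \<in> {..<card F}"
    then have "0 \<le> diameter (U i)" "diameter (U i) \<le> d"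
      using B[OF hF] by (auto simp: U_def diameter_ge_0)
    then show "diam_powr s (U i) \<le> ennreal (d powr s)"
      using s by (auto simp: diam_powr_def intro!: ennreal_leI powr_mono2)
  qed
  also have "\<dots> = ennreal (real (card F) * d powr s)"
    by (simp add: ennreal_mult' ennreal_of_nat_eq_real_of_nat)
  finally show ?thesis .
qed

text \<open>A probability measure that gives a set of diameter \<open>d\<close> mass at most \<open>C d\<^sup>s\<close> forces every cover to
have \<open>s\<close>-cost at least \<open>1 / C\<close>. It is convenient to have the measure on a space of codes and only a
measurable coding map \<open>f\<close>; closed sets suffice because taking closures changes no diameter, and
they make the preimages measurable.\<close>

lemma mass_distribution_principle:
  fixes f :: "'b \<Rightarrow> 'a::metric_space"
  assumes M: "prob_space M" and f: "f \<in> borel_measurable M" and sub: "f ` space M \<subseteq> A"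
    and s: "0 < s" and \<delta>: "0 < \<delta>" and C: "0 \<le> C"
    and bound: "\<And>U. closed U \<Longrightarrow> bounded U \<Longrightarrow> U \<noteq> {} \<Longrightarrow> diameter U \<le> \<delta> \<Longrightarrow>
      emeasure M (f -` U \<inter> space M) \<le> ennreal (C * diameter U powr s)"
  shows "hausdorff_measure s A \<noteq> 0"
proof -
  interpret prob_space M by (rule M)
  have "1 \<le> ennreal C * (\<Sum>i. diam_powr s (U i))"
    if cover: "A \<subseteq> (\<Union>i. U i)" and U: "\<And>i. bounded (U i)" "\<And>i. diameter (U i) \<le> \<delta>"
    for U :: "nat \<Rightarrow> 'a set"
  proof -
    let ?P = "\<lambda>i. f -` closure (U i) \<inter> space M"
    have meas: "?P i \<in> sets M" for i
      using f by (intro measurable_sets[of f M borel]) auto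
    have "1 = emeasure M (space M)" by (simp add: emeasure_space_1)
    also have "\<dots> \<le> emeasure M (\<Union>i. ?P i)"
    proof (rule emeasure_mono)
      show "space M \<subseteq> (\<Union>i. ?P i)"
      proof
        fix w assume w: "w \<in> space M"
        then have "f w \<in> (\<Union>i. U i)" using sub cover by blast
        then obtain i where "f w \<in> U i" by blast
        then have "w \<in> ?P i" using w closure_subset[of "U i"] by blast
        then show "w \<in> (\<Union>i. ?P i)" by blast
      qed
      show "(\<Union>i. ?P i) \<in> sets M" using meas by (intro sets.countable_UN) blast
    qed
    also have "\<dots> \<le> (\<Sum>i. emeasure M (?P i))"
      using meas by (intro emeasure_subadditive_countably) auto
    also have "\<dots> \<le> (\<Sum>i. ennreal C * diam_powr s (U i))"
    proof (intro suminf_le allI)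
      fix i
      show "emeasure M (?P i) \<le> ennreal C * diam_powr s (U i)"
      proof (cases "U i = {}")
        case False
        then have "emeasure M (?P i) \<le> ennreal (C * diameter (closure (U i)) powr s)"
          using U by (intro bound) (auto simp: diameter_closure bounded_closure)
        then show ?thesis
          using False s C U by (simp add: diam_powr_def diameter_closure ennreal_mult')
      qed simp
    qed auto
    finally show ?thesis by simp
  qed
  then have *: "1 \<le> ennreal C * (\<Sum>i. diam_powr s (U i))"
    if "U \<in> {U. A \<subseteq> (\<Union>i. U i) \<and> (\<forall>i. bounded (U i) \<and> diameter (U i) \<le> \<delta>)}" for U
    using that by blast
  have "hausdorff_premeasure s \<delta> A \<noteq> 0"
  proof
    assume "hausdorff_premeasure s \<delta> A = 0"
    then have "hausdorff_premeasure s \<delta> A < ennreal (1 / (C + 1))"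
      using C by simp
    then obtain U where U: "A \<subseteq> (\<Union>i. U i) \<and> (\<forall>i. bounded (U i) \<and> diameter (U i) \<le> \<delta>)"
        "(\<Sum>i. diam_powr s (U i)) < ennreal (1 / (C + 1))"
      unfolding hausdorff_premeasure_def INF_less_iff by blast
    have "1 \<le> ennreal C * (\<Sum>i. diam_powr s (U i))" using * U(1) by blast
    also have "\<dots> \<le> ennreal C * ennreal (1 / (C + 1))"
      using U(2) by (intro mult_left_mono) auto
    also have "\<dots> = ennreal (C / (C + 1))" using C by (simp flip: ennreal_mult')
    finally have "1 \<le> C / (C + 1)" using C by (simp flip: ennreal_1)
    then show False using C by (simp add: field_simps)
  qed
  then show ?thesis using \<delta> by (auto simp: hausdorff_measure_eq_0_iff)
qed

text \<open>Pigeonhole on the cells \<open>\<lfloor>(x - c) / h\<rfloor>\<close>, each of which contains at most one point of \<open>K\<close>.\<close>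

lemma card_separated_le:
  fixes K :: "real set"
  assumes sub: "K \<subseteq> {c..c + L}" and h: "0 < h" and L: "0 \<le> L"
    and sep: "\<And>x y. x \<in> K \<Longrightarrow> y \<in> K \<Longrightarrow> x \<noteq> y \<Longrightarrow> h \<le> \<bar>x - y\<bar>"
  shows "finite K" "real (card K) \<le> L / h + 1"
proof -
  define g where "g x = nat \<lfloor>(x - c) / h\<rfloor>" for x
  have inj: "inj_on g K"
  proof (rule inj_onI, rule ccontr)
    fix x y assume xy: "x \<in> K" "y \<in> K" "g x = g y" "x \<noteq> y"
    have "0 \<le> (x - c) / h" "0 \<le> (y - c) / h" using xy sub h by auto
    then have "\<lfloor>(x - c) / h\<rfloor> = \<lfloor>(y - c) / h\<rfloor>"
      using xy(3) by (simp add: g_def eq_nat_nat_iff)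
    then have "\<bar>(x - c) / h - (y - c) / h\<bar> < 1" by linarith
    moreover have "(x - c) / h - (y - c) / h = (x - y) / h" by (simp add: diff_divide_distrib)
    ultimately have "\<bar>x - y\<bar> < h" using h by (simp add: abs_divide pos_divide_less_eq)
    then show False using sep[OF xy(1,2,4)] by simp
  qed
  have im: "g ` K \<subseteq> {..nat \<lfloor>L / h\<rfloor>}"
    using sub h by (auto simp: g_def intro!: nat_mono floor_mono divide_right_mono)
  show "finite K" using inj im finite_subset finite_imageD by blast
  have "card K \<le> card {..nat \<lfloor>L / h\<rfloor>}" using inj im by (intro card_inj_on_le) auto
  then have "real (card K) \<le> real (nat \<lfloor>L / h\<rfloor>) + 1" by simp
  also have "\<dots> \<le> L / h + 1" using L h by simp
  finally show "real (card K) \<le> L / h + 1" .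
qed

section \<open>Sets with restricted digits\<close>

context remainder_sequence
begin

text \<open>Index 0 is left out of the product, as in \<^const>\<open>Z_set\<close>.\<close>

definition digit_image :: "(nat \<Rightarrow> nat set) \<Rightarrow> real set" where
  "digit_image S = (\<lambda>x. tail x 0) ` (\<Pi>\<^sub>E k\<in>{1..}. S k)"

text \<open>Fixing the first \<open>n\<close> digits confines the value to an interval of length \<open>\<alpha>\<^sub>n + \<alpha>\<^sub>n\<^sub>+\<^sub>1 \<le> 2 \<alpha>\<^sub>n\<close>.\<close>

lemma digit_image_premeasure_le:
  assumes S: "\<And>k. 0 < k \<Longrightarrow> S k \<subseteq> {0..a k}" and s: "0 < s" and \<delta>: "2 * A n \<le> \<delta>"
  shows "hausdorff_premeasure s \<delta> (digit_image S)
    \<le> ennreal (real (\<Prod>k = 1..n. card (S k)) * (2 * A n) powr s)"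
proof -
  let ?F = "\<Pi>\<^sub>E k\<in>{1..n}. S k"
  let ?c = "\<lambda>p. \<Sum>k = 1..n. real (p k) * A k"
  let ?B = "\<lambda>p. {?c p..?c p + 2 * A n}"
  have "hausdorff_premeasure s \<delta> (digit_image S)
      \<le> ennreal (real (card ?F) * (2 * A n) powr s)"
  proof (rule hausdorff_premeasure_finite_cover[where B = ?B])
    show "finite ?F"
      by (intro finite_PiE) (auto intro: finite_subset[OF S])
    show "digit_image S \<subseteq> (\<Union>p\<in>?F. ?B p)"
    proof
      fix t assume "t \<in> digit_image S"
      then obtain x where x: "x \<in> (\<Pi>\<^sub>E k\<in>{1..}. S k)" "t = tail x 0"
        by (auto simp: digit_image_def)
      have le: "x k \<le> a k" if "0 < k" for k
        using PiE_mem[OF x(1), of k] S[OF that] that by auto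
      have "?c (restrict x {1..n}) = ?c x" by (intro sum.cong) auto
      moreover have "tail x 0 = ?c x + tail x n" using le by (rule tail_split)
      moreover have "0 \<le> tail x n" "tail x n \<le> A n + A (Suc n)"
        using le by (auto intro: tail_nonneg tail_le)
      ultimately have "t \<in> ?B (restrict x {1..n})"
        using x(2) A_less[of n] by simp
      moreover have "restrict x {1..n} \<in> ?F" using x(1) by (auto simp: PiE_iff)
      ultimately show "t \<in> (\<Union>p\<in>?F. ?B p)" by blast
    qed
    show "diameter (?B p) \<le> 2 * A n" for p
      using A_pos[of n] by (intro diameter_le) auto
  qed (use s \<delta> A_pos[of n] in auto)
  then show ?thesis by (simp add: card_PiE)
qed

lemma digit_image_null:
  assumes S: "\<And>k. 0 < k \<Longrightarrow> S k \<subseteq> {0..a k}" and s: "0 < s"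
    and freq: "\<And>e. 0 < e \<Longrightarrow>
      \<exists>\<^sub>F n in sequentially. real (\<Prod>k = 1..n. card (S k)) * (2 * A n) powr s < e"
  shows "hausdorff_measure s (digit_image S) = 0"
  unfolding hausdorff_measure_eq_0_iff
proof (intro allI impI)
  fix \<delta> :: real assume \<delta>: "0 < \<delta>"
  have le: "hausdorff_premeasure s \<delta> (digit_image S) \<le> 0 + ennreal e" if e: "0 < e" for e
  proof -
    have "\<forall>\<^sub>F n in sequentially. 2 * A n \<le> \<delta>"
      using order_tendstoD(2)[OF A_tendsto_0, of "\<delta> / 2"] \<delta>
      by (auto elim: eventually_mono)
    from frequently_ex[OF frequently_eventually_frequently[OF freq[OF e] this]]
    obtain n where n: "real (\<Prod>k = 1..n. card (S k)) * (2 * A n) powr s < e" "2 * A n \<le> \<delta>"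
      by blast
    have "hausdorff_premeasure s \<delta> (digit_image S)
        \<le> ennreal (real (\<Prod>k = 1..n. card (S k)) * (2 * A n) powr s)"
      by (rule digit_image_premeasure_le[OF S s n(2)])
    also have "\<dots> \<le> ennreal e" using n(1) by (intro ennreal_leI) simp
    finally show ?thesis by simp
  qed
  have "hausdorff_premeasure s \<delta> (digit_image S) \<le> 0"
    by (rule ennreal_le_epsilon) (rule le)
  then show "hausdorff_premeasure s \<delta> (digit_image S) = 0" by simp
qed

definition digit_measure :: "(nat \<Rightarrow> nat set) \<Rightarrow> (nat \<Rightarrow> nat) measure" where
  "digit_measure S = PiM {1..} (\<lambda>k. uniform_count_measure (S k))"

lemma prob_space_digit_measure:
  assumes "\<And>k. finite (S k)" "\<And>k. S k \<noteq> {}"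
  shows "prob_space (digit_measure S)"
  unfolding digit_measure_def
  by (intro prob_space_PiM prob_space_uniform_count_measure assms)

lemma space_digit_measure: "space (digit_measure S) = (\<Pi>\<^sub>E k\<in>{1..}. S k)"
  by (simp add: digit_measure_def space_PiM space_uniform_count_measure)

lemma tail_measurable: "(\<lambda>x. tail x 0) \<in> borel_measurable (digit_measure S)"
  unfolding tail_def
proof (intro borel_measurable_suminf borel_measurable_times borel_measurable_const)
  fix k
  have "real \<in> borel_measurable (uniform_count_measure (S (Suc k)))"
    by (auto simp: measurable_def sets_uniform_count_measure space_uniform_count_measure)
  then show "(\<lambda>x. real (x (Suc (0 + k)))) \<in> borel_measurable (digit_measure S)"
    unfolding digit_measure_def
    by (intro measurable_compose[OF measurable_component_singleton]) auto
qed

lemma emeasure_cylinder: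
  assumes S: "\<And>k. finite (S k)" "\<And>k. S k \<noteq> {}" and w: "w \<in> space (digit_measure S)"
  shows "emeasure (digit_measure S) {x \<in> space (digit_measure S). \<forall>k\<in>{1..n}. x k = w k}
    = ennreal (1 / real (\<Prod>k = 1..n. card (S k)))"
proof -
  interpret product_prob_space "\<lambda>k. uniform_count_measure (S k)" "{1..}"
    using S by (intro product_prob_spaceI prob_space_uniform_count_measure)
  have wS: "w k \<in> S k" if "k \<in> {1..n}" for k
    using w that by (auto simp: space_digit_measure PiE_iff)
  have "emeasure (digit_measure S) {x \<in> space (digit_measure S). \<forall>k\<in>{1..n}. x k \<in> {w k}}
      = (\<Prod>k\<in>{1..n}. emeasure (uniform_count_measure (S k)) {w k})"
    unfolding digit_measure_def
    by (rule emeasure_PiM_Collect) (use wS in \<open>auto simp: sets_uniform_count_measure\<close>)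
  also have "\<dots> = (\<Prod>k\<in>{1..n}. ennreal (1 / real (card (S k))))"
    using S(1) wS by (intro prod.cong) (simp_all add: emeasure_uniform_count_measure)
  also have "\<dots> = ennreal (\<Prod>k\<in>{1..n}. 1 / real (card (S k)))"
    by (rule prod_ennreal) simp
  finally show ?thesis by (simp add: prod_dividef)
qed

text \<open>An interval of length \<open>\<rho>\<close> meets at most \<open>\<rho> / \<alpha>\<^sub>n + 2\<close> cylinders of length \<open>n\<close>, since the prefix sums of
these cylinders are \<open>\<alpha>\<^sub>n\<close>-separated and tails are smaller than \<open>\<alpha>\<^sub>n\<close>; all cylinders of length \<open>n\<close>
have the same mass.\<close>

lemma digit_measure_interval_le:
  assumes S: "\<And>k. finite (S k)" "\<And>k. S k \<noteq> {}" and lt: "\<And>k. 0 < k \<Longrightarrow> S k \<subseteq> {0..<a k}"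
    and \<rho>: "0 \<le> \<rho>" and U: "U \<subseteq> {c..c + \<rho>}"
  shows "emeasure (digit_measure S) ((\<lambda>x. tail x 0) -` U \<inter> space (digit_measure S))
    \<le> ennreal ((\<rho> / A n + 2) / real (\<Prod>k = 1..n. card (S k)))"
proof -
  let ?M = "digit_measure S" and ?N = "real (\<Prod>k = 1..n. card (S k))"
  define P where "P = (\<lambda>x. tail x 0) -` U \<inter> space ?M"
  define c\<^sub>n where "c\<^sub>n x = (\<Sum>k = 1..n. real (x k) * A k)" for x :: "nat \<Rightarrow> nat"
  have less: "x k < a k" if "x \<in> space ?M" "0 < k" for x k
    using PiE_mem[OF that(1)[unfolded space_digit_measure], of k] lt[OF that(2)] that(2) by auto
  have sep: "A n \<le> \<bar>c\<^sub>n x - c\<^sub>n y\<bar>"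
    if "x \<in> space ?M" "y \<in> space ?M" "\<exists>k\<in>{1..n}. x k \<noteq> y k" for x y
    unfolding c\<^sub>n_def by (rule prefix_sums_separated) (use that less in auto)
  have differ: "\<exists>k\<in>{1..n}. x k \<noteq> y k" if "c\<^sub>n x \<noteq> c\<^sub>n y" for x y
  proof (rule ccontr)
    assume "\<not> ?thesis"
    then have "c\<^sub>n x = c\<^sub>n y" unfolding c\<^sub>n_def by (intro sum.cong) auto
    then show False using that by simp
  qed
  have "c\<^sub>n ` P \<subseteq> {c - A n..(c - A n) + (\<rho> + A n)}"
  proof (intro subsetI, elim imageE)
    fix v x assume x: "x \<in> P" "v = c\<^sub>n x"
    have xM: "x \<in> space ?M" and "tail x 0 \<in> U" using x by (auto simp: P_def)
    then have "c \<le> tail x 0" "tail x 0 \<le> c + \<rho>" using U by auto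
    moreover have "tail x 0 = c\<^sub>n x + tail x n"
      unfolding c\<^sub>n_def by (rule tail_split) (simp add: less[OF xM] less_imp_le)
    moreover have "0 \<le> tail x n" by (rule tail_nonneg) (simp add: less[OF xM] less_imp_le)
    moreover have "tail x n < A n" by (rule tail_less) (simp add: less[OF xM])
    ultimately show "v \<in> {c - A n..(c - A n) + (\<rho> + A n)}" using x(2) by simp
  qed
  note K = card_separated_le[OF this A_pos[of n]]
  have K_sep: "A n \<le> \<bar>u - v\<bar>" if "u \<in> c\<^sub>n ` P" "v \<in> c\<^sub>n ` P" "u \<noteq> v" for u v
    using that sep differ by (auto simp: P_def)
  have fin: "finite (c\<^sub>n ` P)" and card: "real (card (c\<^sub>n ` P)) \<le> (\<rho> + A n) / A n + 1"
    using K[OF _ K_sep] \<rho> A_pos[of n] by simp_all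
  \<comment> \<open>Each prefix sum that occurs determines a cylinder, represented by one of its sequences.\<close>
  define w where "w v = (SOME x. x \<in> P \<and> c\<^sub>n x = v)" for v
  have w: "w v \<in> P" "c\<^sub>n (w v) = v" if "v \<in> c\<^sub>n ` P" for v
  proof -
    have "\<exists>x. x \<in> P \<and> c\<^sub>n x = v" using that by blast
    from someI_ex[OF this] show "w v \<in> P" "c\<^sub>n (w v) = v" by (simp_all add: w_def)
  qed
  define C where "C v = {x \<in> space ?M. \<forall>k\<in>{1..n}. x k = w v k}" for v
  have C: "emeasure ?M (C v) = ennreal (1 / ?N)" if "v \<in> c\<^sub>n ` P" for v
    unfolding C_def using w(1)[OF that] by (intro emeasure_cylinder S) (simp add: P_def)
  have "0 < ?N" using S by (simp add: prod_pos card_gt_0_iff)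
  then have C_sets: "C v \<in> sets ?M" if "v \<in> c\<^sub>n ` P" for v
  proof -
    have "0 < ennreal (1 / ?N)" using \<open>0 < ?N\<close> by (simp only: ennreal_less_zero_iff zero_less_divide_1_iff)
    then show ?thesis unfolding C[OF that, symmetric] by (intro emeasure_neq_0_sets) (rule less_imp_neq[symmetric])
  qed
  have "P \<subseteq> (\<Union>v\<in>c\<^sub>n ` P. C v)"
  proof
    fix x assume x: "x \<in> P"
    let ?v = "c\<^sub>n x"
    have v: "?v \<in> c\<^sub>n ` P" using x by blast
    have "x k = w ?v k" if "k \<in> {1..n}" for k
    proof (rule ccontr)
      assume "x k \<noteq> w ?v k"
      then have "A n \<le> \<bar>c\<^sub>n x - c\<^sub>n (w ?v)\<bar>"
        using x w(1)[OF v] that by (intro sep) (auto simp: P_def)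
      then show False using w(2)[OF v] A_pos[of n] by simp
    qed
    then have "x \<in> C ?v" using x by (simp add: C_def P_def)
    then show "x \<in> (\<Union>v\<in>c\<^sub>n ` P. C v)" using v by blast
  qed
  then have "emeasure ?M P \<le> emeasure ?M (\<Union>v\<in>c\<^sub>n ` P. C v)"
    using fin C_sets by (intro emeasure_mono sets.finite_UN) auto
  also have "\<dots> \<le> (\<Sum>v\<in>c\<^sub>n ` P. emeasure ?M (C v))"
    using fin C_sets by (intro emeasure_subadditive_finite) auto
  also have "\<dots> = (\<Sum>v\<in>c\<^sub>n ` P. ennreal (1 / ?N))" by (intro sum.cong refl C)
  also have "\<dots> = ennreal (real (card (c\<^sub>n ` P)) * (1 / ?N))"
    by (simp add: ennreal_of_nat_eq_real_of_nat flip: ennreal_mult')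
  also have "\<dots> \<le> ennreal ((\<rho> / A n + 2) / ?N)"
  proof (rule ennreal_leI)
    have "(\<rho> + A n) / A n + 1 = \<rho> / A n + 2" using A_pos[of n] by (simp add: add_divide_distrib)
    then have "real (card (c\<^sub>n ` P)) / ?N \<le> (\<rho> / A n + 2) / ?N"
      using card by (intro divide_right_mono of_nat_0_le_iff) simp
    then show "real (card (c\<^sub>n ` P)) * (1 / ?N) \<le> (\<rho> / A n + 2) / ?N" by simp
  qed
  finally show ?thesis by (simp add: P_def)
qed

text \<open>The mass of an interval of length \<open>\<rho>\<close> with \<open>\<alpha>\<^sub>n\<^sub>+\<^sub>1 \<le> \<rho> < \<alpha>\<^sub>n\<close> has to be estimated with cylinders of length
\<open>n + 1\<close>, because \<open>\<alpha>\<^sub>n / \<alpha>\<^sub>n\<^sub>+\<^sub>1\<close> is unbounded when the partial quotients are. As the digit sets contain a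
fixed proportion of the available digits, this gives at most a constant times \<open>\<rho> / \<alpha>\<^sub>n\<close> times the mass
of a cylinder of length \<open>n\<close>. Finally \<open>\<rho> / \<alpha>\<^sub>n \<le> (\<rho> / \<alpha>\<^sub>n)\<^sup>s\<close> for \<open>s \<le> 1\<close>, and the hypothesis on the number of
cylinders absorbs \<open>\<alpha>\<^sub>n\<^sup>-\<^sup>s\<close>.\<close>

lemma digit_image_positive:
  assumes S: "\<And>k. finite (S k)" "\<And>k. S k \<noteq> {}" and lt: "\<And>k. 0 < k \<Longrightarrow> S k \<subseteq> {0..<a k}"
    and s: "0 < s" "s \<le> 1"
    and many: "\<And>n. N \<le> n \<Longrightarrow> a (Suc n) + 1 \<le> 3 * card (S (Suc n))"
    and growth: "\<And>n. N \<le> n \<Longrightarrow> 1 \<le> D * (real (\<Prod>k = 1..n. card (S k)) * A n powr s)"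
  shows "hausdorff_measure s (digit_image S) \<noteq> 0"
proof -
  let ?M = "digit_measure S" and ?f = "\<lambda>x. tail x 0"
  let ?N = "\<lambda>n. real (\<Prod>k = 1..n. card (S k))"
  have N_pos: "0 < ?N n" for n using S by (simp add: prod_pos card_gt_0_iff)
  have D: "0 < D"
  proof (rule ccontr)
    assume "\<not> 0 < D"
    then have "D * (?N N * A N powr s) \<le> 0"
      using N_pos[of N] by (intro mult_nonpos_nonneg mult_nonneg_nonneg) auto
    then show False using growth[of N] by simp
  qed
  interpret prob_space ?M using S by (rule prob_space_digit_measure)
  have scale: "emeasure ?M (?f -` U \<inter> space ?M) \<le> ennreal (9 * D * \<rho> powr s)"
    if \<rho>: "0 < \<rho>" "\<rho> < A N" and U: "U \<subseteq> {c..c + \<rho>}" for U c \<rho>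
  proof -
    have ex: "\<exists>m. A m \<le> \<rho>"
      using order_tendstoD(2)[OF A_tendsto_0 \<rho>(1)] eventually_happens'[OF sequentially_bot]
      by (meson less_imp_le)
    define m where "m = (LEAST m. A m \<le> \<rho>)"
    have m: "A m \<le> \<rho>" unfolding m_def using ex by (rule LeastI_ex)
    have "N < m" using A_antimono[of m N] m \<rho>(2) by (meson leD le_less_linear order_trans)
    then obtain n where n: "m = Suc n" "N \<le> n" by (cases m) auto
    have "\<rho> < A n"
      using not_less_Least[of n "\<lambda>m. A m \<le> \<rho>"] n by (simp add: m_def[symmetric])
    have "emeasure ?M (?f -` U \<inter> space ?M) \<le> ennreal ((\<rho> / A m + 2) / ?N m)"
      using \<rho> U by (intro digit_measure_interval_le S lt) auto
    also have "\<dots> \<le> ennreal (9 * D * \<rho> powr s)"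
    proof (rule ennreal_leI)
      have "A n \<le> (real (a m) + 1) * A m"
        using A_rec[of n] A_less[of m] by (simp add: n(1) distrib_right)
      also have "\<dots> \<le> (3 * real (card (S m))) * A m"
        using many[OF n(2)] A_pos[of m] unfolding n(1)[symmetric]
        by (intro mult_right_mono) (simp_all flip: of_nat_Suc of_nat_add)
      finally have "?N n * A n \<le> ?N n * ((3 * real (card (S m))) * A m)"
        using N_pos[of n] by (intro mult_left_mono) simp_all
      also have "\<dots> = 3 * (A m * ?N m)"
        by (simp add: n(1) mult_ac)
      finally have den: "?N n * A n \<le> 3 * (A m * ?N m)" .
      have "\<rho> / A m + 2 \<le> 3 * (\<rho> / A m)" using m A_pos[of m] by (simp add: field_simps)
      then have "(\<rho> / A m + 2) / ?N m \<le> 3 * (\<rho> / A m) / ?N m"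
        using N_pos[of m] by (intro divide_right_mono) simp_all
      also have "\<dots> = 9 * \<rho> / (3 * (A m * ?N m))" by simp
      also have "\<dots> \<le> 9 * \<rho> / (?N n * A n)"
        using den \<rho>(1) N_pos A_pos by (intro divide_left_mono mult_pos_pos) simp_all
      also have "\<dots> = 9 * (\<rho> / A n) / ?N n" by (simp add: mult_ac)
      also have "\<dots> \<le> 9 * ((\<rho> / A n) powr s) / ?N n"
        using powr_mono'[of s 1 "\<rho> / A n"] s \<open>\<rho> < A n\<close> \<rho>(1) A_pos[of n] N_pos[of n]
        by (intro divide_right_mono mult_left_mono) simp_all
      also have "\<dots> = 9 * \<rho> powr s * (1 / (?N n * A n powr s))"
        using \<rho>(1) A_pos[of n] by (simp add: powr_divide)
      also have "\<dots> \<le> 9 * \<rho> powr s * D"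
        using growth[OF n(2)] N_pos[of n] A_pos[of n]
        by (intro mult_left_mono) (simp_all add: pos_divide_le_eq)
      finally show "(\<rho> / A m + 2) / ?N m \<le> 9 * D * \<rho> powr s" by (simp add: mult_ac)
    qed
    finally show ?thesis .
  qed
  show ?thesis
  proof (rule mass_distribution_principle[where M = ?M and f = ?f and \<delta> = "A N / 2" and C = "9 * D"])
    show "prob_space ?M" using S by (rule prob_space_digit_measure)
    show "?f \<in> borel_measurable ?M" by (rule tail_measurable)
    show "?f ` space ?M \<subseteq> digit_image S" by (simp add: digit_image_def space_digit_measure)
    fix U :: "real set"
    assume U: "bounded U" "U \<noteq> {}" "diameter U \<le> A N / 2"
    let ?d = "diameter U"
    have d: "0 \<le> ?d" "?d < A N" using U A_pos[of N] by (auto simp: diameter_ge_0)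
    have incl: "U \<subseteq> {Inf U..Inf U + ?d}"
    proof
      fix u assume u: "u \<in> U"
      have "u - ?d \<le> v" if "v \<in> U" for v
        using diameter_bounded_bound[OF U(1) u that] by (simp add: dist_real_def)
      then have "u - ?d \<le> Inf U" using U(2) by (intro cInf_greatest)
      moreover have "Inf U \<le> u"
        using u U(1) by (intro cInf_lower bounded_imp_bdd_below)
      ultimately show "u \<in> {Inf U..Inf U + ?d}" by simp
    qed
    \<comment> \<open>The scale estimate needs a positive length, whereas \<open>U\<close> may be a point: approach the diameter from above.\<close>
    have "measure ?M (?f -` U \<inter> space ?M) \<le> 9 * D * \<rho> powr s" if "?d < \<rho>" "\<rho> < A N" for \<rho>
    proof -
      have "emeasure ?M (?f -` U \<inter> space ?M) \<le> ennreal (9 * D * \<rho> powr s)"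
        using that d incl by (intro scale[of \<rho> U "Inf U"]) auto
      then show ?thesis using D by (simp add: emeasure_eq_measure)
    qed
    then have "\<forall>\<^sub>F \<rho> in at_right ?d. measure ?M (?f -` U \<inter> space ?M) \<le> 9 * D * \<rho> powr s"
      using eventually_at_right_real[OF d(2)] by (auto elim: eventually_mono)
    moreover have "((\<lambda>\<rho>. \<rho> powr s) \<longlongrightarrow> ?d powr s) (at_right ?d)"
    proof (rule tendsto_powr2)
      show "((\<lambda>\<rho>. \<rho>) \<longlongrightarrow> ?d) (at_right ?d)" by (rule tendsto_ident_at)
      show "\<forall>\<^sub>F \<rho> in at_right ?d. 0 \<le> \<rho>"
        using eventually_at_right_less[of ?d] d(1) by (auto elim: eventually_mono)
    qed (use s in auto)
    then have "((\<lambda>\<rho>. 9 * D * \<rho> powr s) \<longlongrightarrow> 9 * D * ?d powr s) (at_right ?d)"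
      by (intro tendsto_mult tendsto_const)
    ultimately have "measure ?M (?f -` U \<inter> space ?M) \<le> 9 * D * ?d powr s"
      by (intro tendsto_lowerbound[of _ _ "at_right ?d"]) auto
    then show "emeasure ?M (?f -` U \<inter> space ?M) \<le> ennreal (9 * D * ?d powr s)"
      by (simp add: emeasure_eq_measure ennreal_leI)
  qed (use s D A_pos[of N] in auto)
qed

end

section \<open>Continued fractions\<close>

lemma cf_frac_bounds:
  assumes "\<And>n. 1 \<le> n \<Longrightarrow> 1 \<le> a n" "1 \<le> k"
  shows "0 \<le> cf_frac a k n \<and> cf_frac a k n \<le> 1"
  using assms(2)
proof (induction n arbitrary: k)
  case (Suc n)
  then have "0 \<le> cf_frac a (Suc k) n" "1 \<le> real (a k)" using assms(1)[of k] by simp_all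
  then show ?case by simp
qed simp

text \<open>The tails of the continued fraction converge along with it, one step at a time: inverting
\<open>l = 1 / (a\<^sub>k + l')\<close> is continuous at an irrational \<open>l\<close>, and \<open>l'\<close> is again irrational.\<close>

lemma cf_complete_quotients:
  assumes cf: "regular_cf_expansion \<alpha> a" and irr: "\<alpha> \<notin> \<rat>"
  obtains t where "t 1 = \<alpha>" "\<And>k. 1 \<le> k \<Longrightarrow> 0 < t k \<and> t k < 1"
    "\<And>k. 1 \<le> k \<Longrightarrow> t k * (real (a k) + t (Suc k)) = 1"
proof -
  have a: "\<And>n. 1 \<le> n \<Longrightarrow> 1 \<le> a n" and lim: "cf_frac a 1 \<longlonglongrightarrow> \<alpha>"
    using cf by (auto simp: regular_cf_expansion_def)
  have step: "cf_frac a (Suc k) \<longlonglongrightarrow> 1 / l - real (a k)"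
    "1 / l - real (a k) \<notin> \<rat>" if "cf_frac a k \<longlonglongrightarrow> l" "l \<notin> \<rat>" for k l
  proof -
    have "l \<noteq> 0" using that(2) by auto
    then have "(\<lambda>n. 1 / cf_frac a k (Suc n) - real (a k)) \<longlonglongrightarrow> 1 / l - real (a k)"
      by (intro tendsto_intros LIMSEQ_Suc that(1))
    then show "cf_frac a (Suc k) \<longlonglongrightarrow> 1 / l - real (a k)" by simp
    show "1 / l - real (a k) \<notin> \<rat>"
    proof
      assume "1 / l - real (a k) \<in> \<rat>"
      then have "(1 / l - real (a k)) + real (a k) \<in> \<rat>" by (rule Rats_add) simp
      then have "1 / l \<in> \<rat>" by simp
      then have "1 / (1 / l) \<in> \<rat>" by (rule Rats_divide[OF Rats_1])
      then show False using that(2) by simp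
    qed
  qed
  define t where "t k = lim (cf_frac a k)" for k
  have t: "cf_frac a k \<longlonglongrightarrow> t k \<and> t k \<notin> \<rat>" if "1 \<le> k" for k
    using that
  proof (induction k rule: dec_induct)
    case base
    then show ?case using lim irr by (simp add: t_def limI)
  next
    case (step k)
    then have "cf_frac a (Suc k) \<longlonglongrightarrow> 1 / t k - real (a k)" "1 / t k - real (a k) \<notin> \<rat>"
      using \<open>\<And>k l. cf_frac a k \<longlonglongrightarrow> l \<Longrightarrow> l \<notin> \<rat> \<Longrightarrow> cf_frac a (Suc k) \<longlonglongrightarrow> 1 / l - real (a k)\<close>
        \<open>\<And>k l. cf_frac a k \<longlonglongrightarrow> l \<Longrightarrow> l \<notin> \<rat> \<Longrightarrow> 1 / l - real (a k) \<notin> \<rat>\<close> by blast+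
    then show ?case by (simp add: t_def limI)
  qed
  show thesis
  proof (rule that[of t])
    show "t 1 = \<alpha>" using lim by (simp add: t_def limI)
    fix k :: nat assume k: "1 \<le> k"
    have "0 \<le> t k" "t k \<le> 1"
      using t[OF k] cf_frac_bounds[of a k, OF a k]
      by (auto intro: LIMSEQ_le_const LIMSEQ_le_const2)
    moreover have "t k \<noteq> 0" "t k \<noteq> 1" using t[OF k] by auto
    ultimately show "0 < t k \<and> t k < 1" by simp
    have "t (Suc k) = 1 / t k - real (a k)"
      using t[OF k] t[of "Suc k"] k by (intro LIMSEQ_unique[OF _ step(1)]) simp_all
    then have "real (a k) + t (Suc k) = 1 / t k" by linarith
    then show "t k * (real (a k) + t (Suc k)) = 1" using \<open>t k \<noteq> 0\<close> by simp
  qed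
qed

lemma alpha_seq_0: "alpha_seq \<alpha> a 0 = 1"
  by (simp add: alpha_seq_def)

text \<open>With \<open>t\<^sub>k\<close> the limit of the \<open>k\<close>-th tail of the continued fraction, the signed errors
\<open>d\<^sub>n = q\<^sub>n \<alpha> - p\<^sub>n\<close> satisfy \<open>d\<^sub>n\<^sub>+\<^sub>1 = - t\<^sub>n\<^sub>+\<^sub>1 d\<^sub>n\<close>. They alternate in sign, and \<open>\<alpha>\<^sub>n = t\<^sub>1 \<cdots> t\<^sub>n\<close>.\<close>

lemma alpha_seq_remainders:
  assumes cf: "regular_cf_expansion \<alpha> a" and irr: "\<alpha> \<notin> \<rat>"
  shows "remainder_sequence a (alpha_seq \<alpha> a)"
proof -
  have a: "\<And>n. 1 \<le> n \<Longrightarrow> 1 \<le> a n"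
    using cf by (auto simp: regular_cf_expansion_def)
  from cf_complete_quotients[OF cf irr] obtain t where t: "t 1 = \<alpha>"
      "\<And>k. 1 \<le> k \<Longrightarrow> 0 < t k \<and> t k < 1"
      "\<And>k. 1 \<le> k \<Longrightarrow> t k * (real (a k) + t (Suc k)) = 1"
    by blast
  define d where "d n = real (cf_q a n) * \<alpha> - real (cf_p a n)" for n
  have d_Suc: "d (Suc n) = - t (Suc n) * d n" for n
  proof (induction n)
    case 0
    then show ?case using t(1) by (simp add: d_def)
  next
    case (Suc n)
    have "d (Suc (Suc n)) = real (a (Suc n)) * d (Suc n) + d n"
      by (simp add: d_def algebra_simps)
    also have "d n = (t (Suc n) * (real (a (Suc n)) + t (Suc (Suc n)))) * d n"
      using t(3)[of "Suc n"] by simp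
    also have "\<dots> = - (real (a (Suc n)) + t (Suc (Suc n))) * d (Suc n)"
      unfolding Suc.IH by (simp add: algebra_simps)
    finally show ?case by (simp add: algebra_simps)
  qed
  have A: "alpha_seq \<alpha> a n = \<bar>d n\<bar>" for n by (simp add: alpha_seq_def d_def)
  have A_Suc: "alpha_seq \<alpha> a (Suc n) = t (Suc n) * alpha_seq \<alpha> a n" for n
    using t(2)[of "Suc n"] by (simp add: A d_Suc abs_mult)
  show ?thesis
  proof
    fix n
    show "0 < alpha_seq \<alpha> a n"
    proof (induction n)
      case (Suc n)
      then show ?case using t(2)[of "Suc n"] by (simp add: A_Suc)
    qed (simp add: alpha_seq_0)
    have "alpha_seq \<alpha> a n = t (Suc n) * (real (a (Suc n)) + t (Suc (Suc n))) * alpha_seq \<alpha> a n"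
      using t(3)[of "Suc n"] by simp
    also have "\<dots> = real (a (Suc n)) * alpha_seq \<alpha> a (Suc n) + alpha_seq \<alpha> a (Suc (Suc n))"
      by (simp add: A_Suc algebra_simps)
    finally show "alpha_seq \<alpha> a n
      = real (a (Suc n)) * alpha_seq \<alpha> a (Suc n) + alpha_seq \<alpha> a (Suc (Suc n))" .
  qed (rule a)
qed

context remainder_sequence
begin

lemma cf_q_mono: "cf_q a n \<le> cf_q a (Suc n)"
proof (cases n)
  case (Suc m)
  have "1 * cf_q a (Suc m) \<le> a (Suc m) * cf_q a (Suc m)"
    using a_ge_1[of "Suc m"] by (intro mult_le_mono1) simp
  then show ?thesis unfolding Suc cf_q.simps by linarith
qed simp

lemma cf_q_ge_1: "1 \<le> cf_q a (Suc n)"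
proof (induction n)
  case (Suc n)
  then show ?case using cf_q_mono by (rule order_trans)
qed simp

text \<open>The classical identity \<open>q\<^sub>n\<^sub>+\<^sub>1 \<alpha>\<^sub>n + q\<^sub>n \<alpha>\<^sub>n\<^sub>+\<^sub>1 = 1\<close>; it makes \<open>\<alpha>\<^sub>n\<close> and \<open>1 / q\<^sub>n\<^sub>+\<^sub>1\<close> agree up to a factor 2.\<close>

lemma cf_q_determinant:
  assumes "A 0 = 1"
  shows "real (cf_q a (Suc n)) * A n + real (cf_q a n) * A (Suc n) = 1"
proof (induction n)
  case (Suc n)
  have "real (cf_q a (Suc (Suc n))) * A (Suc n) + real (cf_q a (Suc n)) * A (Suc (Suc n))
      = real (cf_q a (Suc n)) * (real (a (Suc n)) * A (Suc n) + A (Suc (Suc n)))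
        + real (cf_q a n) * A (Suc n)"
    by (simp add: algebra_simps)
  also have "\<dots> = 1" unfolding A_rec[of n, symmetric] by (rule Suc)
  finally show ?case .
qed (simp add: assms)

lemma cf_q_A_le:
  assumes "A 0 = 1"
  shows "real (cf_q a (Suc n)) * A n \<le> 1"
proof -
  have "0 \<le> real (cf_q a n) * A (Suc n)" using A_pos[of "Suc n"] by simp
  then show ?thesis using cf_q_determinant[OF assms, of n] by linarith
qed

lemma cf_q_A_ge:
  assumes "A 0 = 1"
  shows "1 \<le> 2 * (real (cf_q a (Suc n)) * A n)"
proof -
  have "real (cf_q a n) * A (Suc n) \<le> real (cf_q a (Suc n)) * A n"
    using A_less[of n] A_pos[of "Suc n"] cf_q_mono[of n] by (intro mult_mono) simp_all
  then show ?thesis using cf_q_determinant[OF assms, of n] by linarith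
qed

end

section \<open>The dimension of the set of unique expansions\<close>

locale remainder_sequence_ge_2 = remainder_sequence +
  fixes n\<^sub>0 :: nat
  assumes A_0: "A 0 = 1"
    and a_ge_2: "n\<^sub>0 < k \<Longrightarrow> 2 \<le> a k"
begin

definition log_count :: "nat \<Rightarrow> real" where
  "log_count n = (\<Sum>k = n\<^sub>0 + 1..n. ln (real (a k) - 1))"

text \<open>The index is shifted so that \<open>q n\<close> is comparable to \<open>1 / \<alpha>\<^sub>n\<close>.\<close>

definition q :: "nat \<Rightarrow> real" where
  "q n = real (cf_q a (n + 1))"

definition unique_sums :: "real set" where
  "unique_sums = {t \<in> {0<..<1}. \<exists>x. uniquely_expanding x \<and> tail x 0 = t}"

lemma q_ge_1: "1 \<le> q n"
  using cf_q_ge_1[of n] by (simp add: q_def)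

lemma q_A_bounds: "q n * A n \<le> 1" "1 \<le> 2 * (q n * A n)"
  using cf_q_A_le[OF A_0, of n] cf_q_A_ge[OF A_0, of n] by (simp_all add: q_def)

lemma log_count_nonneg: "0 \<le> log_count n"
  unfolding log_count_def
proof (intro sum_nonneg)
  fix k assume "k \<in> {n\<^sub>0 + 1..n}"
  then show "0 \<le> ln (real (a k) - 1)" using a_ge_2[of k] by simp
qed

lemma exp_log_count_Suc:
  "n\<^sub>0 \<le> n \<Longrightarrow> exp (log_count (Suc n)) = exp (log_count n) * (real (a (Suc n)) - 1)"
  using a_ge_2[of "Suc n"] by (simp add: log_count_def exp_add)

lemma card_interior_digits: "n\<^sub>0 < k \<Longrightarrow> real (card {1..<a k}) = real (a k) - 1"
  using a_ge_2[of k] by (simp add: of_nat_diff)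

text \<open>Zeros up to \<open>n\<^sub>0\<close> followed by interior digits are uniquely expanding. The number of such prefixes
of length \<open>n\<close> is the exponential of \<^const>\<open>log_count\<close>,
which by assumption is eventually at least \<open>q\<^sub>n\<^sub>+\<^sub>1\<^sup>c\<close>, and that is \<open>\<alpha>\<^sub>n\<^sup>-\<^sup>c\<close> up to a constant factor.\<close>

lemma hausdorff_dim_unique_sums_pos:
  assumes c: "0 < c" and ev: "\<forall>\<^sub>F n in sequentially. c < log_count n / ln (q n)"
  shows "0 < hausdorff_dim unique_sums"
proof -
  obtain N where N: "\<And>n. N \<le> n \<Longrightarrow> c < log_count n / ln (q n)"
    using ev by (auto simp: eventually_sequentially)
  define s where "s = min c 1"
  have s: "0 < s" "s \<le> 1" "s \<le> c" using c by (auto simp: s_def)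
  define S where "S k = (if k \<le> n\<^sub>0 then {0} else {1..<a k})" for k
  have S: "finite (S k)" "S k \<noteq> {}" for k using a_ge_2[of k] by (auto simp: S_def)
  have S_lt: "S k \<subseteq> {0..<a k}" if "0 < k" for k
    using a_ge_1[of k] that by (auto simp: S_def)
  have S_card: "real (\<Prod>k = 1..n. card (S k)) = exp (log_count n)" for n
  proof (induction n)
    case (Suc n)
    show ?case
    proof (cases "n\<^sub>0 \<le> n")
      case True
      then have "real (card (S (Suc n))) = real (a (Suc n)) - 1"
        using card_interior_digits[of "Suc n"] by (simp add: S_def)
      then show ?thesis using Suc exp_log_count_Suc[OF True] by simp
    next
      case False
      then show ?thesis using Suc by (simp add: S_def log_count_def)
    qed
  qed (simp add: log_count_def)
  have "hausdorff_measure s (digit_image S) \<noteq> 0"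
  proof (rule digit_image_positive[where N = "max N n\<^sub>0" and D = 2])
    fix n assume n: "max N n\<^sub>0 \<le> n"
    \<comment> \<open>Extreme case \<open>a\<^sub>n\<^sub>+\<^sub>1 = 2\<close>, with a single interior digit.\<close>
    show "a (Suc n) + 1 \<le> 3 * card (S (Suc n))"
      using a_ge_2[of "Suc n"] n by (simp add: S_def)
    have "ln (q n) \<noteq> 0" using N[of n] n c by auto
    then have ln: "0 < ln (q n)" using q_ge_1[of n] by (simp add: order_less_le)
    have "s * ln (q n) \<le> c * ln (q n)" using s(3) ln by (intro mult_right_mono) auto
    also have "\<dots> \<le> log_count n" using N[of n] n ln by (simp add: pos_less_divide_eq)
    finally have "q n powr s \<le> exp (log_count n)" using q_ge_1[of n] by (simp add: powr_def)
    moreover have "1 \<le> (2 * (q n * A n)) powr s"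
      using q_A_bounds(2)[of n] s(1) by (intro ge_one_powr_ge_zero) auto
    then have "1 \<le> 2 powr s * (q n powr s * A n powr s)"
      using q_ge_1[of n] A_pos[of n] by (simp add: powr_mult)
    moreover have "2 powr s \<le> (2::real)" using powr_mono[of s 1 "2::real"] s(2) by simp
    ultimately show "1 \<le> 2 * (real (\<Prod>k = 1..n. card (S k)) * A n powr s)"
      unfolding S_card using A_pos[of n]
      by (elim order_trans) (intro mult_mono mult_nonneg_nonneg; simp)
  qed (use S S_lt s in auto)
  moreover have "digit_image S \<subseteq> unique_sums"
  proof
    fix t assume "t \<in> digit_image S"
    then obtain x where x: "x \<in> (\<Pi>\<^sub>E k\<in>{1..}. S k)" "t = tail x 0"
      by (auto simp: digit_image_def)
    have xS: "x k \<in> S k" if "0 < k" for k using PiE_mem[OF x(1), of k] that by simp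
    have less: "x k < a k" if "0 < k" for k using xS[OF that] S_lt[OF that] by auto
    have Z: "x \<in> Z_set a"
      using x(1) less by (auto simp: Z_set_def PiE_iff intro: less_imp_le)
    have "uniquely_expanding x"
    proof (rule uniquely_expandingI[OF Z])
      fix n :: nat assume n: "0 < n"
      show "x (Suc n) < a (Suc n)" by (rule less) simp
      assume "0 < x n"
      then have "n\<^sub>0 < n" using xS[OF n] by (auto simp: S_def split: if_splits)
      then show "0 < x (Suc n)" using xS[of "Suc n"] by (auto simp: S_def split: if_splits)
    qed
    moreover have "tail x 0 < 1" using tail_less[of 0 x] less A_0 by simp
    moreover have "0 < tail x 0"
    proof -
      have le: "x k \<le> a k" if "0 < k" for k using less[OF that] by simp
      have "A (Suc n\<^sub>0) < tail x n\<^sub>0"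
      proof (rule tail_greater)
        fix k assume "n\<^sub>0 < k"
        then show "0 < x k" using xS[of k] by (auto simp: S_def split: if_splits)
      qed (use le in auto)
      moreover have "0 \<le> (\<Sum>k = 1..n\<^sub>0. real (x k) * A k)"
        using A_pos by (intro sum_nonneg mult_nonneg_nonneg) (auto intro: less_imp_le)
      ultimately show ?thesis
        using tail_split[of x n\<^sub>0, OF le] A_pos[of "Suc n\<^sub>0"] by simp
    qed
    ultimately show "t \<in> unique_sums" using x(2) by (auto simp: unique_sums_def)
  qed
  ultimately have "hausdorff_measure s unique_sums \<noteq> 0"
    using hausdorff_measure_mono[of "digit_image S" "unique_sums" s] by auto
  then have "ennreal s \<le> hausdorff_dim unique_sums"
    using s(1) by (intro hausdorff_dim_ge) auto
  moreover have "0 < ennreal s" using s(1) by simp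
  ultimately show ?thesis by (rule less_le_trans[rotated])
qed

text \<open>A uniquely expanding sequence with value in the open unit interval has interior digits from some
index \<open>m\<close> on. For fixed \<open>m\<close>, the number of admissible prefixes of length \<open>n\<close> is at most a constant times the exponential of
\<^const>\<open>log_count\<close>; infinitely often this is below \<open>q\<^sub>n\<^sub>+\<^sub>1\<^sup>s\<^sup>/\<^sup>2\<close>, so the cover by intervals of length
\<open>2 \<alpha>\<^sub>n\<close> costs \<open>O(\<alpha>\<^sub>n\<^sup>s\<^sup>/\<^sup>2)\<close>.\<close>

lemma hausdorff_dim_unique_sums_0:
  assumes few: "\<And>c. 0 < c \<Longrightarrow> \<exists>\<^sub>F n in sequentially. log_count n / ln (q n) < c"
  shows "hausdorff_dim unique_sums = 0"
proof -
  define S where "S m k = (if k \<le> max m n\<^sub>0 then {0..a k} else {1..<a k})" for m k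
  have null: "hausdorff_measure s (digit_image (S m)) = 0" if s: "0 < s" for s m
  proof (rule digit_image_null[OF _ s])
    show "S m k \<subseteq> {0..a k}" for k by (auto simp: S_def)
    define m' where "m' = max m n\<^sub>0"
    define C where "C = real (\<Prod>k = 1..m'. card (S m k))"
    have C0: "0 \<le> C" unfolding C_def by (rule of_nat_0_le_iff)
    have S_card: "real (\<Prod>k = 1..n. card (S m k)) \<le> C * exp (log_count n)" if "m' \<le> n" for n
      using that
    proof (induction n rule: dec_induct)
      case base
      show ?case using mult_left_mono[of 1 "exp (log_count m')" C] C0 log_count_nonneg[of m'] by (simp add: C_def)
    next
      case (step n)
      then have n: "n\<^sub>0 \<le> n" by (simp add: m'_def)
      have "\<not> Suc n \<le> max m n\<^sub>0" using step(1) unfolding m'_def by linarith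
      then have "real (card (S m (Suc n))) = real (a (Suc n)) - 1"
        using card_interior_digits[of "Suc n"] n by (simp add: S_def)
      then have "real (\<Prod>k = 1..Suc n. card (S m k))
          = real (\<Prod>k = 1..n. card (S m k)) * (real (a (Suc n)) - 1)" by simp
      also have "\<dots> \<le> (C * exp (log_count n)) * (real (a (Suc n)) - 1)"
        using step.IH a_ge_2[of "Suc n"] n by (intro mult_right_mono) auto
      finally show ?case using exp_log_count_Suc[OF n] by (simp add: mult_ac)
    qed
    fix e :: real assume e: "0 < e"
    have "(\<lambda>n. A n powr (s / 2)) \<longlonglongrightarrow> 0"
      using s A_pos by (intro tendsto_zero_powrI[OF A_tendsto_0 tendsto_const])
        (auto intro!: always_eventually less_imp_le)
    then have "(\<lambda>n. C * (2 powr s * A n powr (s / 2))) \<longlonglongrightarrow> C * (2 powr s * 0)"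
      by (intro tendsto_mult tendsto_const)
    then have "\<forall>\<^sub>F n in sequentially. C * (2 powr s * A n powr (s / 2)) < e"
      using e by (intro order_tendstoD(2)) auto
    moreover have "\<forall>\<^sub>F n in sequentially. A n < 1 / 2"
      by (rule order_tendstoD(2)[OF A_tendsto_0]) simp
    ultimately have "\<forall>\<^sub>F n in sequentially. C * (2 powr s * A n powr (s / 2)) < e \<and> A n < 1 / 2 \<and> m' \<le> n"
      using eventually_ge_at_top[of m'] by eventually_elim auto
    moreover have "\<exists>\<^sub>F n in sequentially. log_count n / ln (q n) < s / 2" using s by (intro few) simp
    ultimately have "\<exists>\<^sub>F n in sequentially. log_count n / ln (q n) < s / 2 \<and>
        (C * (2 powr s * A n powr (s / 2)) < e \<and> A n < 1 / 2 \<and> m' \<le> n)"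
      by (intro frequently_eventually_frequently)
    then show "\<exists>\<^sub>F n in sequentially. real (\<Prod>k = 1..n. card (S m k)) * (2 * A n) powr s < e"
    proof (rule frequently_elim1, elim conjE)
      fix n assume n: "log_count n / ln (q n) < s / 2" "C * (2 powr s * A n powr (s / 2)) < e"
        "A n < 1 / 2" "m' \<le> n"
      have "1 < q n"
      proof (rule ccontr)
        assume "\<not> 1 < q n"
        then have "q n = 1" using q_ge_1[of n] by simp
        then show False using q_A_bounds(2)[of n] n(3) by simp
      qed
      then have ln: "0 < ln (q n)" by simp
      have "ln (q n) + ln (A n) = ln (q n * A n)"
        using \<open>1 < q n\<close> A_pos[of n] by (simp add: ln_mult)
      also have "\<dots> \<le> 0" using q_A_bounds(1)[of n] \<open>1 < q n\<close> A_pos[of n] by (simp add: ln_le_zero_iff)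
      finally have "ln (q n) \<le> - ln (A n)" by simp
      then have "(s / 2) * ln (q n) \<le> (s / 2) * (- ln (A n))"
        using s by (intro mult_left_mono) auto
      moreover have "log_count n < (s / 2) * ln (q n)" using n(1) ln by (simp add: pos_divide_less_eq)
      ultimately have "exp (log_count n) \<le> exp (- (s / 2) * ln (A n))" by simp
      then have "exp (log_count n) \<le> A n powr (- (s / 2))" using A_pos[of n] by (simp add: powr_def)
      then have "exp (log_count n) * A n powr s \<le> A n powr (- (s / 2)) * A n powr s"
        by (intro mult_right_mono) auto
      also have "\<dots> = A n powr (s / 2)" by (simp flip: powr_add)
      finally have le: "exp (log_count n) * A n powr s \<le> A n powr (s / 2)" .
      have "real (\<Prod>k = 1..n. card (S m k)) * (2 * A n) powr s \<le> (C * exp (log_count n)) * (2 * A n) powr s"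
        using S_card[OF n(4)] by (intro mult_right_mono) auto
      also have "\<dots> = C * (2 powr s * (exp (log_count n) * A n powr s))"
        using A_pos[of n] by (simp add: powr_mult)
      also have "\<dots> \<le> C * (2 powr s * A n powr (s / 2))"
        using le C0 by (intro mult_left_mono) auto
      also note n(2)
      finally show "real (\<Prod>k = 1..n. card (S m k)) * (2 * A n) powr s < e" .
    qed
  qed
  have sub: "unique_sums \<subseteq> (\<Union>m. digit_image (S m))"
  proof
    fix t assume "t \<in> unique_sums"
    then obtain x where x: "uniquely_expanding x" "tail x 0 = t" and t: "0 < t" "t < 1"
      by (auto simp: unique_sums_def)
    have "\<exists>m. \<forall>k>m. 0 < x k \<and> x k < a k"
      using t x A_0 A_pos[of 1] by (intro unique_eventually_interior) auto
    then obtain m where m: "\<And>k. m < k \<Longrightarrow> 0 < x k \<and> x k < a k" by blast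
    have Z: "x \<in> Z_set a" using x(1) by (simp add: uniquely_expanding_def)
    have "x k \<in> S m k" if "k \<in> {1..}" for k
    proof (cases "k \<le> max m n\<^sub>0")
      case True
      then show ?thesis using Z_set_le[OF Z, of k] that by (simp add: S_def)
    next
      case False
      then have "m < k" by (simp add: le_max_iff_disj)
      then show ?thesis using m[of k] False by (simp add: S_def)
    qed
    then have "x \<in> (\<Pi>\<^sub>E k\<in>{1..}. S m k)"
      using Z by (auto simp: Z_set_def PiE_iff)
    then show "t \<in> (\<Union>m. digit_image (S m))" using x(2) by (auto simp: digit_image_def)
  qed
  have "hausdorff_dim unique_sums \<le> 0 + ennreal s" if "0 < s" for s
  proof -
    have "hausdorff_measure s unique_sums \<le> hausdorff_measure s (\<Union>m. digit_image (S m))"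
      using sub by (rule hausdorff_measure_mono)
    also have "\<dots> = 0" by (rule hausdorff_measure_UN_null) (rule null[OF that])
    finally show ?thesis using that by (simp add: hausdorff_dim_le)
  qed
  then have "hausdorff_dim unique_sums \<le> 0" by (rule ennreal_le_epsilon)
  then show ?thesis by simp
qed

end

lemma V_set_eq_unique_sums:
  assumes "remainder_sequence_ge_2 a (alpha_seq \<alpha> a) n\<^sub>0"
  shows "V_set \<alpha> a = remainder_sequence_ge_2.unique_sums a (alpha_seq \<alpha> a)"
proof -
  interpret remainder_sequence_ge_2 a "alpha_seq \<alpha> a" n\<^sub>0 by (rule assms)
  have eq: "x \<in> Z_set a \<and> (\<lambda>n. real (x (Suc n)) * alpha_seq \<alpha> a (Suc n)) sums t
      \<longleftrightarrow> x \<in> Z_set a \<and> tail x 0 = t" for x t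
    using summable_tail[of 0 x] Z_set_le[of x] by (auto simp: tail_def sums_iff)
  have "(\<exists>!x. x \<in> Z_set a \<and> tail x 0 = t) \<longleftrightarrow> (\<exists>x. uniquely_expanding x \<and> tail x 0 = t)" for t
  proof
    assume "\<exists>!x. x \<in> Z_set a \<and> tail x 0 = t"
    then obtain x where x: "x \<in> Z_set a \<and> tail x 0 = t"
        and "\<forall>y. y \<in> Z_set a \<and> tail y 0 = t \<longrightarrow> y = x"
      by (rule ex1E)
    then have "uniquely_expanding x" unfolding uniquely_expanding_def by blast
    then show "\<exists>x. uniquely_expanding x \<and> tail x 0 = t" using x by blast
  next
    assume "\<exists>x. uniquely_expanding x \<and> tail x 0 = t"
    then obtain x where x: "uniquely_expanding x" "tail x 0 = t" by blast
    show "\<exists>!x. x \<in> Z_set a \<and> tail x 0 = t"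
      by (rule ex1I[of _ x]) (use x in \<open>auto simp: uniquely_expanding_def\<close>)
  qed
  then show ?thesis by (simp only: V_set_def unique_sums_def eq)
qed

theorem theorem3p18:
  fixes \<alpha> :: real and a :: "nat \<Rightarrow> nat" and n\<^sub>0 :: nat
  assumes "0 < \<alpha>" and "\<alpha> < 1" and "\<alpha> \<notin> \<rat>"
    and "regular_cf_expansion \<alpha> a"
    and "finite {n. n \<ge> 1 \<and> a n = 1}"
    and "n\<^sub>0 = Sup {n. n \<ge> 1 \<and> a n = 1}"
  shows "hausdorff_dim (V_set \<alpha> a) > 0 \<longleftrightarrow>
    liminf (\<lambda>n. ereal ((\<Sum>k = n\<^sub>0 + 1..n. ln (real (a k) - 1)) / ln (real (cf_q a (n + 1))))) > 0"
proof -
  have rs: "remainder_sequence a (alpha_seq \<alpha> a)" using assms(4,3) by (rule alpha_seq_remainders)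
  have ge_2: "remainder_sequence_ge_2 a (alpha_seq \<alpha> a) n\<^sub>0"
  proof (intro remainder_sequence_ge_2.intro rs remainder_sequence_ge_2_axioms.intro)
    show "alpha_seq \<alpha> a 0 = 1" by (rule alpha_seq_0)
    fix k assume k: "n\<^sub>0 < k"
    have "a k \<noteq> 1"
    proof
      assume "a k = 1"
      then have "k \<in> {n. n \<ge> 1 \<and> a n = 1}" using k by simp
      then have "k \<le> n\<^sub>0"
        unfolding assms(6) using assms(5) by (intro cSup_upper bdd_above_finite)
      then show False using k by simp
    qed
    then show "2 \<le> a k" using remainder_sequence.a_ge_1[OF rs, of k] k by linarith
  qed
  interpret remainder_sequence_ge_2 a "alpha_seq \<alpha> a" n\<^sub>0 by (rule ge_2)
  let ?r = "\<lambda>n. log_count n / ln (q n)"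
  have "0 < hausdorff_dim unique_sums \<longleftrightarrow> 0 < liminf (\<lambda>n. ereal (?r n))"
  proof
    assume "0 < liminf (\<lambda>n. ereal (?r n))"
    then obtain c where c: "0 < ereal c" "ereal c < liminf (\<lambda>n. ereal (?r n))"
      using ereal_dense2[of 0] by auto
    from less_LiminfD[OF c(2)] have "\<forall>\<^sub>F n in sequentially. c < ?r n" by simp
    then show "0 < hausdorff_dim unique_sums"
      using c(1) by (intro hausdorff_dim_unique_sums_pos[of c]) simp_all
  next
    assume pos: "0 < hausdorff_dim unique_sums"
    show "0 < liminf (\<lambda>n. ereal (?r n))"
    proof (rule ccontr)
      assume not_pos: "\<not> ?thesis"
      have "\<exists>\<^sub>F n in sequentially. ?r n < c" if c: "0 < c" for c
      proof (rule ccontr)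
        assume "\<not> ?thesis"
        then have "\<forall>\<^sub>F n in sequentially. ereal c \<le> ereal (?r n)"
          by (simp add: not_frequently not_less)
        then have "ereal c \<le> liminf (\<lambda>n. ereal (?r n))"
          by (rule Liminf_bounded)
        moreover have "0 < ereal c" using c by simp
        ultimately show False using not_pos less_le_trans by blast
      qed
      then have "hausdorff_dim unique_sums = 0" by (rule hausdorff_dim_unique_sums_0)
      then show False using pos by simp
    qed
  qed
  then show ?thesis
    unfolding V_set_eq_unique_sums[OF ge_2] log_count_def q_def .
qed

end
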